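(* Let $q=q_1q_2\cdots q_k$ be a fixed permutation pattern of length $k$. For $n>k$, let $X_n$ be the random variable counting the occurrences (copies) of $q$ in a permutation of length $n$ chosen uniformly at random. Then $$\tilde{X}_n=\frac{X_n-E(X_n)}{\sqrt{\operatorname{Var}(X_n)}}\rightarrow N(0,1)$$ as $n\to\infty$, where the convergence is in distribution to the standard normal variable. In other words, $X_n$ is asymptotically normal.
   Context: A permutation of length $n$ is written in one-line notation $p=p_1p_2\cdots p_n$ and is selected at random with each of the $n!$ permutations having probability $1/n!$. A permutation pattern of length $k$ is a permutation $q=q_1\cdots q_k$. An occurrence (copy) of $q$ in $p$ is a set of positions $1\leq i_1<i_2<\cdots<i_k\leq n$ (not necessarily consecutive) such that for all indices $j$ and $r$, $q_j<q_r$ if and only if $p_{i_j}<p_{i_r}$. Thus $X_n$ is the number of $k$-element subsets of positions of $p$ whose entries relate to each other in the same way as the entries of $q$.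
   Formalization: The pattern length is assumed to be k ≥ 2; for k = 1 (where X_n = n) and k = 0 (where X_n = 1) the count is constant, so Var(X_n) = 0 and the standardized variable is undefined. *)

theory Defs
  imports "HOL-Probability.Probability" "HOL-Combinatorics.Permutations"
begin

text \<open>A permutation \<open>p\<^sub>1 p\<^sub>2 \<dots> p\<^sub>n\<close> in one-line notation is a function \<open>p\<close> with
  \<open>p permutes {1..n}\<close>, the \<open>i\<close>-th entry being \<open>p i\<close>.\<close>

definition random_permutation :: "nat \<Rightarrow> (nat \<Rightarrow> nat) pmf" where
  "random_permutation n = pmf_of_set {p. p permutes {1..n}}"

text \<open>The map \<open>i\<close> lists the positions in \<open>S\<close> as \<open>i\<^sub>1 < i\<^sub>2 < \<dots> < i\<^sub>k\<close>.\<close>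

definition pattern_occurrence ::
  "nat \<Rightarrow> (nat \<Rightarrow> nat) \<Rightarrow> nat \<Rightarrow> (nat \<Rightarrow> nat) \<Rightarrow> nat set \<Rightarrow> bool" where
  "pattern_occurrence k q n p S \<longleftrightarrow>
     S \<subseteq> {1..n} \<and>
     (\<exists>i. strict_mono_on {1..k} i \<and> i ` {1..k} = S \<and>
        (\<forall>j\<in>{1..k}. \<forall>r\<in>{1..k}. q j < q r \<longleftrightarrow> p (i j) < p (i r)))"

definition num_occurrences ::
  "nat \<Rightarrow> (nat \<Rightarrow> nat) \<Rightarrow> nat \<Rightarrow> (nat \<Rightarrow> nat) \<Rightarrow> nat" where
  "num_occurrences k q n p = card {S. pattern_occurrence k q n p S}"

definition standardized :: "'a pmf \<Rightarrow> ('a \<Rightarrow> real) \<Rightarrow> 'a \<Rightarrow> real" where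
  "standardized M X = (\<lambda>x. (X x - measure_pmf.expectation M X) / sqrt (measure_pmf.variance M X))"

end

(* Draw n independent uniform points in the unit square. Sorting them by abscissa and reading off
   the ranks of the ordinates gives a uniform random permutation, in which an occurrence of q is a
   k-subset of the points that forms the pattern q. Hence X_n has the law of a U-statistic with a
   symmetric kernel of order k. Hoeffding's decomposition writes it as its mean, plus
   binomial(n-1,k-1) times a sum of the i.i.d. variables h(Z_i) - theta, where h(z) is the probability
   that z together with k - 1 random points forms q, plus an uncorrelated remainder whose variance
   is smaller by a factor O(1/n). The central limit theorem for the i.i.d. sum therefore carries over,
   provided that h is not almost surely constant. The mean of h is positive; a point near the
   lower (upper) left corner of the square is almost always the leftmost point and the lowest (highest)
   one, and it cannot play this role in q if q_2 < q_1 (if q_1 < q_2), so that h is arbitrarily small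
   there. *)

theory Submission
  imports Defs
begin

text \<open>The entries of a random permutation are dependent, so no limit theorem for independent
  summands applies to them directly. Mean, variance and standardization depend only on the law of
  X_n, hence an equality in law for each n with the count for random points is enough. It is
  obtained without order statistics: with the coordinates fixed, the ordinates are shuffled by all
  permutations. Conditioning is replaced by integration over an independent copy of some
  coordinates, on one infinite product space for all n. All orthogonality for the remainder then
  comes from one fact: the centred kernel \<open>g S\<close> averages to 0 when all points of
  \<open>S\<close> but one are resampled. So \<open>g S\<close> and \<open>g T\<close> are
  orthogonal unless \<open>S\<close> and \<open>T\<close> share two indices, and such pairs are rare
  enough. The standardization uses the exact variance of X_n. No asymptotic formula for it is
  required: it splits exactly into two parts, and every error is a function of their ratio. The case
  k = 1 is excluded because every permutation then has exactly n copies of q.\<close>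

section \<open>Product measures: reindexing and resampling of coordinates\<close>

text \<open>Replacing the coordinates in \<open>J\<close> by independent copies; this stands in for conditioning on
  the other coordinates.\<close>

lemma distr_PiM_mix:
  fixes N :: "'b measure" and J :: "'i set"
  assumes "prob_space N"
  defines "\<Omega> \<equiv> PiM UNIV (\<lambda>_::'i. N)"
  shows "distr (\<Omega> \<Otimes>\<^sub>M \<Omega>) \<Omega> (\<lambda>(\<omega>', \<omega>) i. if i \<in> J then \<omega>' i else \<omega> i) = \<Omega>"
proof -
  interpret N: prob_space N by fact
  interpret P: product_prob_space "\<lambda>_::'i. N" UNIV by unfold_locales
  interpret O: prob_space \<Omega> unfolding \<Omega>_def by (rule P.prob_space_axioms)
  interpret OO: pair_prob_space \<Omega> \<Omega> ..
  let ?f = "\<lambda>(\<omega>', \<omega>) i. if i \<in> J then \<omega>' i else \<omega> i :: 'b"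
  have [measurable]: "?f \<in> \<Omega> \<Otimes>\<^sub>M \<Omega> \<rightarrow>\<^sub>M \<Omega>"
    unfolding \<Omega>_def by (auto intro!: measurable_PiM_single' simp: space_PiM space_pair_measure split_beta PiE_iff)
  have "\<Omega> = distr (\<Omega> \<Otimes>\<^sub>M \<Omega>) \<Omega> ?f"
    unfolding \<Omega>_def
  proof (rule measure_eqI_PiM_infinite)
    fix A :: "'i \<Rightarrow> 'b set" and L :: "'i set"
    assume L: "finite L" and A: "\<And>i. i \<in> L \<Longrightarrow> A i \<in> sets N"
    let ?E = "\<lambda>K. prod_emb UNIV (\<lambda>_. N) (K::'i set) (Pi\<^sub>E K A)"
    have E: "?E K = {\<omega>\<in>space \<Omega>. \<forall>i\<in>K. \<omega> i \<in> A i}" for K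
      by (auto simp: prod_emb_def \<Omega>_def space_PiM PiE_iff)
    have [measurable]: "?E K \<in> sets \<Omega>" if "K \<subseteq> L" for K
      using that L A finite_subset[of K L] unfolding \<Omega>_def by (intro sets_PiM_I) auto
    \<comment> \<open>Cylinders determine the measure, and a cylinder over \<open>L\<close> pulls
      back to a rectangle: the copy carries the constraints on \<open>L \<inter> J\<close>, the
      original those on \<open>L - J\<close>.\<close>
    have "?f -` ?E L \<inter> space (\<Omega> \<Otimes>\<^sub>M \<Omega>) = ?E (L \<inter> J) \<times> ?E (L - J)"
    proof (rule set_eqI; clarify)
      fix \<omega>' \<omega> :: "'i \<Rightarrow> 'b"
      have "?f (\<omega>', \<omega>) \<in> space \<Omega>" if "\<omega>' \<in> space \<Omega>" "\<omega> \<in> space \<Omega>"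
        using that by (auto simp: \<Omega>_def space_PiM PiE_iff)
      then show "(\<omega>', \<omega>) \<in> ?f -` ?E L \<inter> space (\<Omega> \<Otimes>\<^sub>M \<Omega>) \<longleftrightarrow> (\<omega>', \<omega>) \<in> ?E (L \<inter> J) \<times> ?E (L - J)"
        unfolding E space_pair_measure by (auto split: if_splits)
    qed
    then have "emeasure (distr (\<Omega> \<Otimes>\<^sub>M \<Omega>) \<Omega> ?f) (?E L) = emeasure (\<Omega> \<Otimes>\<^sub>M \<Omega>) (?E (L \<inter> J) \<times> ?E (L - J))"
      by (subst emeasure_distr) simp_all
    also have "\<dots> = emeasure \<Omega> (?E (L \<inter> J)) * emeasure \<Omega> (?E (L - J))"
      by (intro O.emeasure_pair_measure_Times) auto
    also have "\<dots> = (\<Prod>i\<in>L \<inter> J. emeasure N (A i)) * (\<Prod>i\<in>L - J. emeasure N (A i))"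
      using L A unfolding \<Omega>_def by (subst (1 2) P.emeasure_PiM_emb) auto
    also have "\<dots> = (\<Prod>i\<in>L. emeasure N (A i))"
      using L by (subst prod.union_disjoint[symmetric]) (auto intro!: prod.cong)
    also have "\<dots> = emeasure \<Omega> (?E L)"
      using L A unfolding \<Omega>_def by (subst P.emeasure_PiM_emb) auto
    finally show "emeasure (PiM UNIV (\<lambda>_. N)) (?E L) =
      emeasure (distr (PiM UNIV (\<lambda>_. N) \<Otimes>\<^sub>M PiM UNIV (\<lambda>_. N)) (PiM UNIV (\<lambda>_. N)) ?f) (?E L)"
      unfolding \<Omega>_def ..
  qed (use O.finite_measure_axioms in \<open>auto simp: \<Omega>_def\<close>)
  then show ?thesis ..
qed

text \<open>An injective relabelling of i.i.d. coordinates may forget some of them but keeps the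
  law. It serves both to move an index set to \<open>{1..k}\<close> and to shuffle
  ordinates.\<close>

lemma distr_PiM_comp_inj:
  fixes N :: "'b measure" and \<sigma> :: "'i \<Rightarrow> 'i"
  assumes "prob_space N" "inj \<sigma>"
  shows "distr (PiM UNIV (\<lambda>_. N)) (PiM UNIV (\<lambda>_. N)) (\<lambda>\<omega>. \<omega> \<circ> \<sigma>) = PiM UNIV (\<lambda>_. N)"
  using distr_PiM_reindex[of UNIV "\<lambda>_. N" \<sigma> UNIV] assms by (simp add: comp_def restrict_def)

lemma integral_PiM_comp_inj:
  fixes f :: "('i \<Rightarrow> 'b) \<Rightarrow> real" and \<sigma> :: "'i \<Rightarrow> 'i"
  assumes "prob_space N" "inj \<sigma>" and [measurable]: "f \<in> borel_measurable (PiM UNIV (\<lambda>_. N))"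
  shows "(\<integral>\<omega>. f (\<omega> \<circ> \<sigma>) \<partial>PiM UNIV (\<lambda>_. N)) = (\<integral>\<omega>. f \<omega> \<partial>PiM UNIV (\<lambda>_. N))"
proof -
  have [measurable]: "(\<lambda>\<omega>. \<omega> \<circ> \<sigma>) \<in> PiM UNIV (\<lambda>_. N) \<rightarrow>\<^sub>M PiM UNIV (\<lambda>_. N)"
    by (auto intro!: measurable_PiM_single' simp: space_PiM PiE_iff comp_def)
  show ?thesis
    by (subst (2) distr_PiM_comp_inj[OF assms(1,2), symmetric]) (simp add: integral_distr)
qed

text \<open>Fubini for the resampled sequence. The inner integral plays the role of the conditional
  expectation given the coordinates outside \<open>J\<close>.\<close>

lemma integral_PiM_mix:
  fixes f :: "('i \<Rightarrow> 'b) \<Rightarrow> real" and J :: "'i set"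
  assumes "prob_space N" and [measurable]: "f \<in> borel_measurable (PiM UNIV (\<lambda>_. N))"
    and bound: "\<And>\<omega>. \<omega> \<in> space (PiM UNIV (\<lambda>_. N)) \<Longrightarrow> \<bar>f \<omega>\<bar> \<le> B"
  shows "(\<integral>\<omega>. f \<omega> \<partial>PiM UNIV (\<lambda>_. N)) =
    (\<integral>\<omega>. (\<integral>\<omega>'. f (\<lambda>i. if i \<in> J then \<omega>' i else \<omega> i) \<partial>PiM UNIV (\<lambda>_. N)) \<partial>PiM UNIV (\<lambda>_. N))"
proof -
  define \<Omega> where "\<Omega> = PiM UNIV (\<lambda>_::'i. N)"
  note [measurable] = assms(2)[folded \<Omega>_def]
  interpret N: prob_space N by fact
  interpret P: product_prob_space "\<lambda>_::'i. N" UNIV by unfold_locales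
  interpret O: prob_space \<Omega> unfolding \<Omega>_def by (rule P.prob_space_axioms)
  interpret OO: pair_prob_space \<Omega> \<Omega> ..
  define mix where "mix \<omega>' \<omega> = (\<lambda>i. if i \<in> J then \<omega>' i else \<omega> i :: 'b)" for \<omega>' \<omega>
  have mix: "distr (\<Omega> \<Otimes>\<^sub>M \<Omega>) \<Omega> (\<lambda>(\<omega>', \<omega>). mix \<omega>' \<omega>) = \<Omega>"
    using distr_PiM_mix[OF assms(1), of J] by (simp only: \<Omega>_def mix_def)
  have m: "(\<lambda>(\<omega>', \<omega>). mix \<omega>' \<omega>) \<in> \<Omega> \<Otimes>\<^sub>M \<Omega> \<rightarrow>\<^sub>M \<Omega>"
    unfolding \<Omega>_def mix_def
    by (auto intro!: measurable_PiM_single' simp: space_PiM space_pair_measure split_beta PiE_iff)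
  have [measurable]: "(\<lambda>(\<omega>', \<omega>). f (mix \<omega>' \<omega>)) \<in> borel_measurable (\<Omega> \<Otimes>\<^sub>M \<Omega>)"
    using measurable_compose[OF m, of f] by (simp add: split_beta)
  have "integral\<^sup>L \<Omega> f = integral\<^sup>L (distr (\<Omega> \<Otimes>\<^sub>M \<Omega>) \<Omega> (\<lambda>(\<omega>', \<omega>). mix \<omega>' \<omega>)) f"
    by (simp only: mix)
  also have "\<dots> = (\<integral>(\<omega>', \<omega>). f (mix \<omega>' \<omega>) \<partial>(\<Omega> \<Otimes>\<^sub>M \<Omega>))"
    by (subst integral_distr[OF m]) (simp_all add: case_prod_unfold)
  also have "\<dots> = (\<integral>\<omega>. (\<integral>\<omega>'. f (mix \<omega>' \<omega>) \<partial>\<Omega>) \<partial>\<Omega>)"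
  proof (intro OO.integral_snd[symmetric] OO.integrable_const_bound[where B=B] AE_I2)
    fix p assume "p \<in> space (\<Omega> \<Otimes>\<^sub>M \<Omega>)"
    then show "norm (case p of (\<omega>', \<omega>) \<Rightarrow> f (mix \<omega>' \<omega>)) \<le> B"
      using bound[folded \<Omega>_def] measurable_space[OF m] by (cases p) auto
  qed simp
  finally show ?thesis unfolding \<Omega>_def mix_def .
qed

section \<open>Bounded measurable functions and perturbation in mean square\<close>

text \<open>A class closed under sums, products and measurable substitution whose members are all
  integrable on a probability space: one set of rules then settles the integrability of every
  polynomial in the kernel and its projections.\<close>

definition bounded_measurable :: "'a measure \<Rightarrow> ('a \<Rightarrow> real) \<Rightarrow> bool" where
  "bounded_measurable M f \<longleftrightarrow> f \<in> borel_measurable M \<and> (\<exists>B. \<forall>x\<in>space M. \<bar>f x\<bar> \<le> B)"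

named_theorems bounded_measurable_intros

lemma bounded_measurableI:
  "f \<in> borel_measurable M \<Longrightarrow> (\<And>x. x \<in> space M \<Longrightarrow> \<bar>f x\<bar> \<le> B) \<Longrightarrow> bounded_measurable M f"
  unfolding bounded_measurable_def by blast

lemma bounded_measurableD: "bounded_measurable M f \<Longrightarrow> f \<in> borel_measurable M"
  unfolding bounded_measurable_def by blast

lemma bounded_measurable_const [bounded_measurable_intros]: "bounded_measurable M (\<lambda>_. c)"
  unfolding bounded_measurable_def by auto

lemma bounded_measurable_add [bounded_measurable_intros]:
  assumes "bounded_measurable M f" "bounded_measurable M g"
  shows "bounded_measurable M (\<lambda>x. f x + g x)"
proof -
  obtain B C where "\<forall>x\<in>space M. \<bar>f x\<bar> \<le> B" "\<forall>x\<in>space M. \<bar>g x\<bar> \<le> C"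
    using assms unfolding bounded_measurable_def by auto
  then show ?thesis using assms unfolding bounded_measurable_def
    by (intro conjI exI[of _ "B + C"] ballI) (auto intro!: order_trans[OF abs_triangle_ineq] add_mono)
qed

lemma bounded_measurable_mult [bounded_measurable_intros]:
  assumes "bounded_measurable M f" "bounded_measurable M g"
  shows "bounded_measurable M (\<lambda>x. f x * g x)"
proof -
  obtain B C where "\<forall>x\<in>space M. \<bar>f x\<bar> \<le> B" "\<forall>x\<in>space M. \<bar>g x\<bar> \<le> C"
    using assms unfolding bounded_measurable_def by auto
  then show ?thesis using assms unfolding bounded_measurable_def
    by (intro conjI exI[of _ "\<bar>B\<bar> * \<bar>C\<bar>"] ballI) (auto simp: abs_mult intro!: mult_mono intro: order_trans[OF _ abs_ge_self])
qed

lemma bounded_measurable_diff [bounded_measurable_intros]: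
  "bounded_measurable M f \<Longrightarrow> bounded_measurable M g \<Longrightarrow> bounded_measurable M (\<lambda>x. f x - g x)"
  using bounded_measurable_add[of M f "\<lambda>x. -1 * g x"] bounded_measurable_mult[OF bounded_measurable_const[of M "-1"]]
  by simp

lemma bounded_measurable_divide [bounded_measurable_intros]:
  "bounded_measurable M f \<Longrightarrow> bounded_measurable M (\<lambda>x. f x / c)"
  using bounded_measurable_mult[OF _ bounded_measurable_const[of M "1 / c"]] by simp

lemma bounded_measurable_power2 [bounded_measurable_intros]:
  "bounded_measurable M f \<Longrightarrow> bounded_measurable M (\<lambda>x. (f x)\<^sup>2)"
  unfolding power2_eq_square by (rule bounded_measurable_mult)

lemma bounded_measurable_abs [bounded_measurable_intros]:
  "bounded_measurable M f \<Longrightarrow> bounded_measurable M (\<lambda>x. \<bar>f x\<bar>)"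
  unfolding bounded_measurable_def by auto

lemma bounded_measurable_sum [bounded_measurable_intros]:
  "(\<And>i. i \<in> I \<Longrightarrow> bounded_measurable M (f i)) \<Longrightarrow> bounded_measurable M (\<lambda>x. \<Sum>i\<in>I. f i x)"
  by (induction I rule: infinite_finite_induct) (auto intro: bounded_measurable_intros)

lemma bounded_measurable_compose:
  "bounded_measurable N f \<Longrightarrow> g \<in> M \<rightarrow>\<^sub>M N \<Longrightarrow> bounded_measurable M (\<lambda>x. f (g x))"
  unfolding bounded_measurable_def by (auto dest: measurable_space)

lemma (in prob_space) integrable_bounded_measurable:
  "bounded_measurable M f \<Longrightarrow> integrable M f"
  unfolding bounded_measurable_def by (metis AE_I2 integrable_const_bound real_norm_def)

text \<open>At each \<open>t\<close> the two characteristic functions differ by at most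
  \<open>\<bar>t\<bar>\<close> times the mean of \<open>\<bar>A n x - B n x\<bar>\<close>, hence by
  at most \<open>\<bar>t\<bar>\<close> times the root mean square; Levy's continuity theorem does
  the rest.\<close>

lemma (in prob_space) weak_conv_m_L2_perturbation:
  fixes A B :: "nat \<Rightarrow> 'a \<Rightarrow> real"
  assumes bm: "\<And>n. bounded_measurable M (A n)" "\<And>n. bounded_measurable M (B n)"
    and conv: "weak_conv_m (\<lambda>n. distr M borel (A n)) L" and L: "real_distribution L"
    and close: "(\<lambda>n. expectation (\<lambda>x. (A n x - B n x)\<^sup>2)) \<longlonglongrightarrow> 0"
  shows "weak_conv_m (\<lambda>n. distr M borel (B n)) L"
proof (rule levy_continuity[OF _ L])
  note [measurable] = bm[THEN bounded_measurableD]
  have rd: "real_distribution (distr M borel f)" if "f \<in> borel_measurable M" for f :: "'a \<Rightarrow> real"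
    using that by (rule real_distribution_distr)
  show "real_distribution (distr M borel (B n))" for n by (rule rd) simp
  fix t :: real
  have A: "(\<lambda>n. char (distr M borel (A n)) t) \<longlonglongrightarrow> char L t"
    by (rule levy_continuity1[OF _ L conv]) (rule rd, simp)
  have char: "char (distr M borel f) t = (CLINT x|M. iexp (t * f x))" if [measurable]: "f \<in> borel_measurable M"
    for f :: "'a \<Rightarrow> real" unfolding char_def by (subst integral_distr) auto
  have int: "integrable M (\<lambda>x. iexp (t * f x))" if [measurable]: "f \<in> borel_measurable M" for f :: "'a \<Rightarrow> real"
    by (intro integrable_const_bound[where B=1]) (auto simp: norm_exp_i_times)
  have bound: "cmod (char (distr M borel (B n)) t - char (distr M borel (A n)) t)
      \<le> \<bar>t\<bar> * sqrt (expectation (\<lambda>x. (A n x - B n x)\<^sup>2))" for n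
  proof -
    have "cmod (char (distr M borel (B n)) t - char (distr M borel (A n)) t)
        = cmod (CLINT x|M. iexp (t * B n x) - iexp (t * A n x))"
      by (subst (1 2) char, simp, simp, subst Bochner_Integration.integral_diff[OF int int]) simp_all
    also have "\<dots> \<le> expectation (\<lambda>x. cmod (iexp (t * B n x) - iexp (t * A n x)))"
      by (rule integral_norm_bound)
    also have "\<dots> \<le> expectation (\<lambda>x. \<bar>t\<bar> * \<bar>A n x - B n x\<bar>)"
    proof (rule integral_mono)
      show "integrable M (\<lambda>x. cmod (iexp (t * B n x) - iexp (t * A n x)))"
        by (intro integrable_norm Bochner_Integration.integrable_diff int) auto
      show "integrable M (\<lambda>x. \<bar>t\<bar> * \<bar>A n x - B n x\<bar>)"
        by (intro integrable_mult_right integrable_abs integrable_bounded_measurable bounded_measurable_diff bm)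
      fix x
      have "iexp (t * B n x) - iexp (t * A n x) = iexp (t * A n x) * (iexp (t * (B n x - A n x)) - 1)"
        by (simp add: algebra_simps flip: exp_add)
      then have "cmod (iexp (t * B n x) - iexp (t * A n x)) = cmod (iexp (t * (B n x - A n x)) - 1)"
        by (simp only: norm_mult norm_exp_i_times mult_1)
      also have "\<dots> \<le> \<bar>t * (B n x - A n x)\<bar>"
        using iexp_approx1[of "t * (B n x - A n x)" 0] by simp
      finally show "cmod (iexp (t * B n x) - iexp (t * A n x)) \<le> \<bar>t\<bar> * \<bar>A n x - B n x\<bar>"
        by (simp add: abs_mult abs_minus_commute)
    qed
    also have "\<dots> = \<bar>t\<bar> * expectation (\<lambda>x. \<bar>A n x - B n x\<bar>)" by simp
    \<comment> \<open>Cauchy-Schwarz, in the form that the variance of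
      \<open>\<bar>A n x - B n x\<bar>\<close> is nonnegative.\<close>
    also have "expectation (\<lambda>x. \<bar>A n x - B n x\<bar>) \<le> sqrt (expectation (\<lambda>x. (A n x - B n x)\<^sup>2))"
    proof (rule real_le_rsqrt)
      have "integrable M (\<lambda>x. \<bar>A n x - B n x\<bar>)" "integrable M (\<lambda>x. \<bar>A n x - B n x\<bar>\<^sup>2)"
        using bm by (auto intro!: integrable_abs integrable_bounded_measurable bounded_measurable_intros)
      from variance_eq[OF this] show "(expectation (\<lambda>x. \<bar>A n x - B n x\<bar>))\<^sup>2 \<le> expectation (\<lambda>x. (A n x - B n x)\<^sup>2)"
        using variance_positive[of "\<lambda>x. \<bar>A n x - B n x\<bar>"] by simp
    qed
    finally show ?thesis by (simp add: mult_left_mono)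
  qed
  have "(\<lambda>n. \<bar>t\<bar> * sqrt (expectation (\<lambda>x. (A n x - B n x)\<^sup>2))) \<longlonglongrightarrow> \<bar>t\<bar> * sqrt 0"
    by (intro tendsto_intros close)
  then have "(\<lambda>n. char (distr M borel (B n)) t - char (distr M borel (A n)) t) \<longlonglongrightarrow> 0"
    by (intro Lim_null_comparison[OF always_eventually[OF allI[OF bound]]]) simp
  from tendsto_add[OF this A] show "(\<lambda>n. char (distr M borel (B n)) t) \<longlonglongrightarrow> char L t" by simp
qed

section \<open>The Hoeffding decomposition of a U-statistic\<close>

lemma card_supersets:
  assumes "finite A" "D \<subseteq> A" "card D \<le> k"
  shows "card {S. S \<subseteq> A \<and> card S = k \<and> D \<subseteq> S} = (card A - card D) choose (k - card D)"
proof -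
  have fD: "finite D" using assms finite_subset by auto
  have "bij_betw (\<lambda>S. S \<union> D) {S. S \<subseteq> A - D \<and> card S = k - card D} {S. S \<subseteq> A \<and> card S = k \<and> D \<subseteq> S}"
  proof (rule bij_betwI[where g="\<lambda>S. S - D"])
    show "(\<lambda>S. S \<union> D) \<in> {S. S \<subseteq> A - D \<and> card S = k - card D} \<rightarrow> {S. S \<subseteq> A \<and> card S = k \<and> D \<subseteq> S}"
    proof (intro funcsetI CollectI conjI; elim CollectE conjE)
      fix S assume S: "S \<subseteq> A - D" "card S = k - card D"
      have "finite S" using S assms(1) by (meson finite_Diff finite_subset)
      then have "card (S \<union> D) = card S + card D" using S fD by (intro card_Un_disjoint) auto
      then show "card (S \<union> D) = k" using S assms by simp
    qed (use assms in auto)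
    show "(\<lambda>S. S - D) \<in> {S. S \<subseteq> A \<and> card S = k \<and> D \<subseteq> S} \<rightarrow> {S. S \<subseteq> A - D \<and> card S = k - card D}"
      using fD by (auto simp: card_Diff_subset)
  qed auto
  then have "card {S. S \<subseteq> A \<and> card S = k \<and> D \<subseteq> S} = card {S. S \<subseteq> A - D \<and> card S = k - card D}"
    by (simp add: bij_betw_same_card)
  also have "\<dots> = (card A - card D) choose (k - card D)"
    using assms fD by (simp add: n_subsets card_Diff_subset)
  finally show ?thesis .
qed

text \<open>Relabelling a sequence needs an injection on all of \<open>nat\<close>, not only on
  \<open>{1..card S}\<close>. The prescribed value at 1 carries a point held fixed at index
  \<open>i\<close> to the index 1 that \<open>h\<close> uses.\<close>

lemma obtain_inj_image:
  fixes S :: "nat set"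
  assumes "finite S" "i \<in> S"
  obtains \<sigma> :: "nat \<Rightarrow> nat" where "inj \<sigma>" "\<sigma> ` {1..card S} = S" "\<sigma> 1 = i"
proof -
  have c: "card S \<ge> 1" using assms by (metis One_nat_def Suc_leI card_gt_0_iff empty_iff)
  have "card {2..card S} = card (S - {i})" using assms by simp
  then obtain e where e: "bij_betw e {2..card S} (S - {i})"
    using assms by (metis finite_Diff finite_atLeastAtMost finite_same_card_bij)
  \<comment> \<open>The indices outside \<open>{1..card S}\<close>, 0 among them, are shifted beyond
    \<open>Max S\<close>, where they meet neither \<open>S\<close> nor each other.\<close>
  define \<sigma> where "\<sigma> j = (if j = 1 then i else if j \<in> {2..card S} then e j else j + Suc (Max S))" for j
  have S: "Suc (j + Max S) \<notin> S" for j
    using Max_ge[OF assms(1), of "Suc (j + Max S)"] by linarith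
  have eS: "e j \<in> S" "e j \<noteq> i" if "j \<in> {2..card S}" for j
    using bij_betwE[OF e] that by auto
  have inj: "inj \<sigma>"
  proof (rule injI)
    fix x y assume eq: "\<sigma> x = \<sigma> y"
    show "x = y"
      using eq assms eS[of x] eS[of y] S[of x] S[of y] inj_onD[OF bij_betw_imp_inj_on[OF e], of x y]
      by (auto simp: \<sigma>_def split: if_splits)
  qed
  have "{1..card S} = insert 1 {2..card S}" using c by auto
  moreover have "\<sigma> ` {2..card S} = e ` {2..card S}" by (intro image_cong) (auto simp: \<sigma>_def)
  moreover have "\<sigma> 1 = i" by (simp add: \<sigma>_def)
  ultimately have im: "\<sigma> ` {1..card S} = S"
    using bij_betw_imp_surj_on[OF e] assms by (simp only: image_insert insert_Diff)
  show ?thesis using that[OF inj im] by (simp add: \<sigma>_def)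
qed

section \<open>Symmetric kernels and their first-order projection\<close>

text \<open>\<open>\<phi> S\<close> reads the whole sequence instead of a k-tuple, so that no order
  of the k arguments has to be chosen. \<open>\<phi>_local\<close> says that only the points with
  index in \<open>S\<close> matter; \<open>\<phi>_image\<close> combines symmetry in the arguments
  with invariance under relabelling.\<close>

locale symmetric_kernel = N: prob_space N for N :: "'b measure" +
  fixes k :: nat and \<phi> :: "nat set \<Rightarrow> (nat \<Rightarrow> 'b) \<Rightarrow> real" and B :: real
  assumes k_ge_2: "k \<ge> 2"
    and \<phi>_measurable: "finite S \<Longrightarrow> \<phi> S \<in> borel_measurable (PiM UNIV (\<lambda>_. N))"
    and \<phi>_bounded: "\<bar>\<phi> S \<omega>\<bar> \<le> B"
    and \<phi>_local: "(\<And>i. i \<in> S \<Longrightarrow> \<omega> i = \<omega>' i) \<Longrightarrow> \<phi> S \<omega> = \<phi> S \<omega>'"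
    and \<phi>_image: "inj \<sigma> \<Longrightarrow> finite S \<Longrightarrow> \<phi> (\<sigma> ` S) \<omega> = \<phi> S (\<omega> \<circ> \<sigma>)"
begin

definition \<Omega> :: "(nat \<Rightarrow> 'b) measure" where "\<Omega> = PiM UNIV (\<lambda>_. N)"

definition \<theta> :: real where "\<theta> = (\<integral>\<omega>. \<phi> {1..k} \<omega> \<partial>\<Omega>)"

text \<open>The conditional expectation of the kernel given one of its points. The choice of index 1
  is immaterial by \<open>integral_\<phi>_upd\<close>.\<close>

definition h :: "'b \<Rightarrow> real" where "h z = (\<integral>\<omega>. \<phi> {1..k} (fun_upd \<omega> 1 z) \<partial>\<Omega>)"

definition U :: "nat \<Rightarrow> (nat \<Rightarrow> 'b) \<Rightarrow> real" where
  "U n \<omega> = (\<Sum>S | S \<subseteq> {1..n} \<and> card S = k. \<phi> S \<omega>)"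

text \<open>The kernel minus its constant and first-order parts. What remains has mean 0 given any
  single point of \<open>S\<close>, which is the content of \<open>integral_g_mult\<close>.\<close>

definition g :: "nat set \<Rightarrow> (nat \<Rightarrow> 'b) \<Rightarrow> real" where
  "g S \<omega> = \<phi> S \<omega> - \<theta> - (\<Sum>i\<in>S. h (\<omega> i) - \<theta>)"

definition H :: "nat \<Rightarrow> (nat \<Rightarrow> 'b) \<Rightarrow> real" where "H n \<omega> = (\<Sum>i=1..n. h (\<omega> i) - \<theta>)"

definition R :: "nat \<Rightarrow> (nat \<Rightarrow> 'b) \<Rightarrow> real" where
  "R n \<omega> = (\<Sum>S | S \<subseteq> {1..n} \<and> card S = k. g S \<omega>)"

definition \<sigma>2 :: real where "\<sigma>2 = (\<integral>z. (h z - \<theta>)\<^sup>2 \<partial>N)"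

sublocale P: product_prob_space "\<lambda>_::nat. N" UNIV
  by unfold_locales

sublocale O: prob_space \<Omega>
  unfolding \<Omega>_def by (rule P.prob_space_axioms)

lemma component_measurable [measurable]: "(\<lambda>\<omega>. \<omega> i) \<in> \<Omega> \<rightarrow>\<^sub>M N"
  unfolding \<Omega>_def by measurable

lemma bm_\<phi>: "finite S \<Longrightarrow> bounded_measurable \<Omega> (\<phi> S)"
  using \<phi>_measurable \<phi>_bounded unfolding \<Omega>_def by (rule bounded_measurableI)

lemma fun_upd_measurable: "(\<lambda>(z, \<omega>). fun_upd \<omega> i z) \<in> N \<Otimes>\<^sub>M \<Omega> \<rightarrow>\<^sub>M \<Omega>"
  unfolding \<Omega>_def
  by (intro measurable_PiM_single')
    (auto simp: space_PiM space_pair_measure PiE_iff split_beta fun_upd_def)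

lemma bm_\<phi>_upd: "finite S \<Longrightarrow> z \<in> space N \<Longrightarrow> bounded_measurable \<Omega> (\<lambda>\<omega>. \<phi> S (fun_upd \<omega> i z))"
  using measurable_compose[OF measurable_Pair1' fun_upd_measurable]
  by (intro bounded_measurable_compose[OF bm_\<phi>]) simp_all

lemma h_bounded: "z \<in> space N \<Longrightarrow> \<bar>h z\<bar> \<le> B"
proof -
  assume z: "z \<in> space N"
  have "\<bar>h z\<bar> \<le> (\<integral>\<omega>. \<bar>\<phi> {1..k} (fun_upd \<omega> 1 z)\<bar> \<partial>\<Omega>)" unfolding h_def by (rule integral_abs_bound)
  also have "\<dots> \<le> (\<integral>\<omega>. B \<partial>\<Omega>)"
    using \<phi>_bounded bm_\<phi>_upd[OF _ z]
    by (intro integral_mono O.integrable_bounded_measurable bounded_measurable_abs bounded_measurable_const) simp_all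
  finally show ?thesis by (simp add: O.prob_space)
qed

lemma bm_h: "bounded_measurable N h"
proof (rule bounded_measurableI[OF _ h_bounded])
  have "(\<lambda>p. \<phi> {1..k} ((\<lambda>(z, \<omega>). fun_upd \<omega> 1 z) p)) \<in> borel_measurable (N \<Otimes>\<^sub>M \<Omega>)"
    using measurable_compose[OF fun_upd_measurable bounded_measurableD[OF bm_\<phi>]] by simp
  then have [measurable]: "(\<lambda>(z, \<omega>). \<phi> {1..k} (fun_upd \<omega> 1 z)) \<in> borel_measurable (N \<Otimes>\<^sub>M \<Omega>)"
    by (simp add: case_prod_unfold)
  show "h \<in> borel_measurable N" unfolding h_def by measurable
qed

lemma bm_h_component: "bounded_measurable \<Omega> (\<lambda>\<omega>. h (\<omega> i))"
  by (rule bounded_measurable_compose[OF bm_h]) measurable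

lemma bm_g: "finite S \<Longrightarrow> bounded_measurable \<Omega> (g S)"
  unfolding g_def by (intro bounded_measurable_intros bm_\<phi> bm_h_component)

lemma bm_H: "bounded_measurable \<Omega> (H n)"
  unfolding H_def by (intro bounded_measurable_intros bm_h_component)

lemma finite_subset_index: "S \<in> {S. S \<subseteq> {1..n} \<and> card S = k} \<Longrightarrow> finite S" for n :: nat
  using finite_subset by blast

lemma bm_R: "bounded_measurable \<Omega> (R n)"
  unfolding R_def by (intro bounded_measurable_intros bm_g finite_subset_index)

lemma bm_U: "bounded_measurable \<Omega> (U n)"
  unfolding U_def by (intro bounded_measurable_intros bm_\<phi> finite_subset_index)

lemma integral_component: "f \<in> borel_measurable N \<Longrightarrow> (\<integral>\<omega>. f (\<omega> i) \<partial>\<Omega>) = (\<integral>z. f z \<partial>N)"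
  for f :: "'b \<Rightarrow> real"
  using distr_PiM_component[of UNIV "\<lambda>_. N" i] N.prob_space_axioms
  by (subst integral_distr[symmetric, where N=N]) (simp_all add: \<Omega>_def)

lemma integral_\<phi>:
  assumes "finite S" "card S = k"
  shows "(\<integral>\<omega>. \<phi> S \<omega> \<partial>\<Omega>) = \<theta>"
proof -
  obtain i where "i \<in> S" using assms k_ge_2 by fastforce
  with assms obtain \<sigma> where \<sigma>: "inj \<sigma>" "\<sigma> ` {1..k} = S" using obtain_inj_image by metis
  then have "\<phi> S \<omega> = \<phi> {1..k} (\<omega> \<circ> \<sigma>)" for \<omega> using \<phi>_image[OF \<sigma>(1), of "{1..k}"] by simp
  then show ?thesis
    using integral_PiM_comp_inj[OF N.prob_space_axioms \<sigma>(1) \<phi>_measurable] by (simp add: \<theta>_def \<Omega>_def)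
qed

text \<open>Under an injection that sends \<open>{1..k}\<close> onto \<open>S\<close> and 1 to
  \<open>i\<close>, overwriting at \<open>i\<close> becomes overwriting at 1.\<close>

lemma integral_\<phi>_upd:
  assumes "finite S" "card S = k" "i \<in> S" and z: "z \<in> space N"
  shows "(\<integral>\<omega>. \<phi> S (fun_upd \<omega> i z) \<partial>\<Omega>) = h z"
proof -
  obtain \<sigma> where \<sigma>: "inj \<sigma>" "\<sigma> ` {1..k} = S" "\<sigma> 1 = i"
    using assms obtain_inj_image by metis
  have "\<phi> S (fun_upd \<omega> i z) = \<phi> {1..k} (fun_upd (\<omega> \<circ> \<sigma>) 1 z)" for \<omega>
  proof -
    have "fun_upd \<omega> i z \<circ> \<sigma> = fun_upd (\<omega> \<circ> \<sigma>) 1 z"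
      using \<sigma>(1,3) by (auto simp: fun_eq_iff dest: injD)
    then show ?thesis using \<phi>_image[OF \<sigma>(1), of "{1..k}" "fun_upd \<omega> i z"] \<sigma>(2) by simp
  qed
  then show ?thesis
    using integral_PiM_comp_inj[OF N.prob_space_axioms \<sigma>(1), of "\<lambda>\<omega>. \<phi> {1..k} (fun_upd \<omega> 1 z)"]
      bounded_measurableD[OF bm_\<phi>_upd[of "{1..k}" z 1]] z
    by (simp add: h_def \<Omega>_def)
qed

lemma integral_h_component: "(\<integral>\<omega>. h (\<omega> i) \<partial>\<Omega>) = \<theta>"
proof -
  \<comment> \<open>Resampling every coordinate except 1 produces an independent copy overwritten at
    1 by \<open>\<omega> 1\<close>, whose inner mean is \<open>h (\<omega> 1)\<close>.\<close>
  have "\<theta> = (\<integral>\<omega>. (\<integral>\<omega>'. \<phi> {1..k} (\<lambda>i. if i \<in> - {1} then \<omega>' i else \<omega> i) \<partial>\<Omega>) \<partial>\<Omega>)"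
    unfolding \<theta>_def \<Omega>_def
    by (rule integral_PiM_mix[OF N.prob_space_axioms \<phi>_measurable \<phi>_bounded]) simp
  moreover have "(\<lambda>i. if i \<in> - {1} then \<omega>' i else \<omega> i) = fun_upd \<omega>' 1 (\<omega> 1)" for \<omega> \<omega>' :: "nat \<Rightarrow> 'b"
    by (auto simp: fun_eq_iff)
  ultimately have "\<theta> = (\<integral>\<omega>. h (\<omega> 1) \<partial>\<Omega>)" unfolding h_def by (simp only:)
  then show ?thesis using integral_component[OF bounded_measurableD[OF bm_h]] by simp
qed

lemma integral_centered: "(\<integral>\<omega>. h (\<omega> i) - \<theta> \<partial>\<Omega>) = 0"
  using integral_h_component O.integrable_bounded_measurable[OF bm_h_component] by (simp add: O.prob_space)

text \<open>Resampling \<open>J\<close> leaves \<open>G\<close> fixed, so \<open>G\<close> leaves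
  the inner integral as a constant, and the inner mean of \<open>F\<close> vanishes.\<close>

lemma integral_mult_zero:
  assumes F: "bounded_measurable \<Omega> F" and G: "bounded_measurable \<Omega> G"
    and zero: "\<And>\<omega>. \<omega> \<in> space \<Omega> \<Longrightarrow> (\<integral>\<omega>'. F (\<lambda>i. if i \<in> J then \<omega>' i else \<omega> i) \<partial>\<Omega>) = 0"
    and local: "\<And>\<omega> \<omega>'. (\<And>i. i \<notin> J \<Longrightarrow> \<omega> i = \<omega>' i) \<Longrightarrow> G \<omega> = G \<omega>'"
  shows "(\<integral>\<omega>. F \<omega> * G \<omega> \<partial>\<Omega>) = 0"
proof -
  define mix where "mix \<omega>' \<omega> = (\<lambda>i. if i \<in> J then \<omega>' i else \<omega> i :: 'b)" for \<omega>' \<omega>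
  obtain C where C: "\<And>\<omega>. \<omega> \<in> space \<Omega> \<Longrightarrow> \<bar>F \<omega> * G \<omega>\<bar> \<le> C"
    using bounded_measurable_mult[OF F G] unfolding bounded_measurable_def by blast
  have "(\<integral>\<omega>. F \<omega> * G \<omega> \<partial>\<Omega>) = (\<integral>\<omega>. (\<integral>\<omega>'. F (mix \<omega>' \<omega>) * G (mix \<omega>' \<omega>) \<partial>\<Omega>) \<partial>\<Omega>)"
    unfolding mix_def \<Omega>_def
  proof (rule integral_PiM_mix[OF N.prob_space_axioms, where B=C])
    show "(\<lambda>\<omega>. F \<omega> * G \<omega>) \<in> borel_measurable (PiM UNIV (\<lambda>_. N))"
      using bounded_measurable_mult[OF F G, THEN bounded_measurableD] by (simp only: \<Omega>_def)
  qed (use C in \<open>simp only: \<Omega>_def\<close>)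
  also have "\<dots> = (\<integral>\<omega>. 0 \<partial>\<Omega>)"
  proof (rule Bochner_Integration.integral_cong[OF refl])
    fix \<omega> assume "\<omega> \<in> space \<Omega>"
    moreover have "G (mix \<omega>' \<omega>) = G \<omega>" for \<omega>' by (rule local) (simp add: mix_def)
    ultimately show "(\<integral>\<omega>'. F (mix \<omega>' \<omega>) * G (mix \<omega>' \<omega>) \<partial>\<Omega>) = 0"
      using zero by (simp add: mix_def)
  qed
  finally show ?thesis by simp
qed

lemma integral_centered_mult:
  assumes "bounded_measurable \<Omega> G"
    and "\<And>\<omega> \<omega>'. (\<And>j. j \<noteq> i \<Longrightarrow> \<omega> j = \<omega>' j) \<Longrightarrow> G \<omega> = G \<omega>'"
  shows "(\<integral>\<omega>. (h (\<omega> i) - \<theta>) * G \<omega> \<partial>\<Omega>) = 0"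
proof (rule integral_mult_zero[where J="{i}", OF _ assms(1)])
  show "bounded_measurable \<Omega> (\<lambda>\<omega>. h (\<omega> i) - \<theta>)"
    by (intro bounded_measurable_intros bm_h_component)
  show "G \<omega> = G \<omega>'" if "\<And>j. j \<notin> {i} \<Longrightarrow> \<omega> j = \<omega>' j" for \<omega> \<omega>'
    by (rule assms(2)) (simp add: that)
qed (use integral_centered in simp)

text \<open>Given the point \<open>i\<close> alone, \<open>\<phi> S\<close> averages to
  \<open>h (\<omega> i)\<close> and every other centred summand to 0, so \<open>g S\<close> averages
  to 0. The factor \<open>G\<close> may therefore depend on \<open>\<omega> i\<close> and on
  everything outside \<open>S\<close>; all later orthogonality relations for \<open>g\<close> are
  instances.\<close>

lemma integral_g_mult:
  assumes S: "finite S" "card S = k" "i \<in> S"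
    and G: "bounded_measurable \<Omega> G"
    and local: "\<And>\<omega> \<omega>'. (\<And>j. j \<notin> S - {i} \<Longrightarrow> \<omega> j = \<omega>' j) \<Longrightarrow> G \<omega> = G \<omega>'"
  shows "(\<integral>\<omega>. g S \<omega> * G \<omega> \<partial>\<Omega>) = 0"
proof (rule integral_mult_zero[where J="S - {i}", OF bm_g[OF S(1)] G _ local])
  fix \<omega> assume "\<omega> \<in> space \<Omega>"
  then have z: "\<omega> i \<in> space N" by (simp add: \<Omega>_def space_PiM PiE_iff)
  have eq: "g S (\<lambda>j. if j \<in> S - {i} then \<omega>' j else \<omega> j) =
      \<phi> S (fun_upd \<omega>' i (\<omega> i)) - h (\<omega> i) - (\<Sum>j\<in>S - {i}. h (\<omega>' j) - \<theta>)" for \<omega>'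
  proof -
    have "\<phi> S (\<lambda>j. if j \<in> S - {i} then \<omega>' j else \<omega> j) = \<phi> S (fun_upd \<omega>' i (\<omega> i))"
      by (rule \<phi>_local) auto
    moreover have "(\<Sum>j\<in>S. h (if j \<in> S - {i} then \<omega>' j else \<omega> j) - \<theta>) =
        (h (\<omega> i) - \<theta>) + (\<Sum>j\<in>S - {i}. h (\<omega>' j) - \<theta>)"
      using S by (subst sum.remove[of S i]) (auto intro!: sum.cong)
    ultimately show ?thesis unfolding g_def by simp
  qed
  note int = O.integrable_bounded_measurable
  have "(\<integral>\<omega>'. \<phi> S (fun_upd \<omega>' i (\<omega> i)) - h (\<omega> i) - (\<Sum>j\<in>S - {i}. h (\<omega>' j) - \<theta>) \<partial>\<Omega>)
     = (\<integral>\<omega>'. \<phi> S (fun_upd \<omega>' i (\<omega> i)) - h (\<omega> i) \<partial>\<Omega>) - (\<integral>\<omega>'. (\<Sum>j\<in>S - {i}. h (\<omega>' j) - \<theta>) \<partial>\<Omega>)"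
    using S z by (intro Bochner_Integration.integral_diff int bounded_measurable_intros bm_\<phi>_upd bm_h_component)
  also have "(\<integral>\<omega>'. \<phi> S (fun_upd \<omega>' i (\<omega> i)) - h (\<omega> i) \<partial>\<Omega>) = 0"
    using int[OF bm_\<phi>_upd[OF S(1) z, of i]] integral_\<phi>_upd[OF S z] by (simp add: O.prob_space)
  also have "(\<integral>\<omega>'. (\<Sum>j\<in>S - {i}. h (\<omega>' j) - \<theta>) \<partial>\<Omega>) = 0"
    using integral_centered
    by (subst Bochner_Integration.integral_sum)
      (intro int bounded_measurable_intros bm_h_component, simp only: sum.neutral_const)
  also have "0 - 0 = (0::real)" by simp
  finally show "(\<integral>\<omega>'. g S (\<lambda>j. if j \<in> S - {i} then \<omega>' j else \<omega> j) \<partial>\<Omega>) = 0"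
    by (simp only: eq)
qed

end

section \<open>Counting k-subsets by an element or by their overlap\<close>

text \<open>Double counting: each index lies in \<open>(n - 1) choose (k - 1)\<close> of the
  k-subsets. This is the coefficient of the linear term \<open>H n\<close>.\<close>

lemma sum_over_subsets:
  fixes a :: "nat \<Rightarrow> real"
  assumes "k \<ge> 1"
  shows "(\<Sum>S | S \<subseteq> {1..n} \<and> card S = k. \<Sum>i\<in>S. a i) = ((n - 1) choose (k - 1)) * (\<Sum>i=1..n. a i)"
proof -
  let ?I = "{S. S \<subseteq> {1..n} \<and> card S = k}"
  have fin: "finite ?I" by simp
  have "(\<Sum>S\<in>?I. \<Sum>i\<in>S. a i) = (\<Sum>S\<in>?I. \<Sum>i=1..n. if i \<in> S then a i else 0)"
  proof (rule sum.cong[OF refl])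
    fix S assume "S \<in> ?I"
    then have "S = {1..n} \<inter> S" by auto
    then show "(\<Sum>i\<in>S. a i) = (\<Sum>i=1..n. if i \<in> S then a i else 0)"
      by (metis finite_atLeastAtMost sum.inter_restrict)
  qed
  also have "\<dots> = (\<Sum>i=1..n. \<Sum>S\<in>?I. if i \<in> S then a i else 0)" by (rule sum.swap)
  also have "\<dots> = (\<Sum>i=1..n. ((n - 1) choose (k - 1)) * a i)"
  proof (intro sum.cong refl)
    fix i assume "i \<in> {1..n}"
    then have "card {S. S \<subseteq> {1..n} \<and> card S = k \<and> {i} \<subseteq> S} = (n - 1) choose (k - 1)"
      using card_supersets[of "{1..n}" "{i}" k] assms by simp
    moreover have "?I \<inter> {S. i \<in> S} = {S. S \<subseteq> {1..n} \<and> card S = k \<and> {i} \<subseteq> S}" by auto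
    ultimately show "(\<Sum>S\<in>?I. if i \<in> S then a i else 0) = ((n - 1) choose (k - 1)) * a i"
      using fin by (simp only: sum.If_cases sum.neutral_const sum_constant)
  qed
  finally show ?thesis by (simp add: sum_distrib_left)
qed

text \<open>Union bound over the ordered pairs of distinct common elements: there are at most
  \<open>k\<^sup>2\<close> such pairs in \<open>S\<close>, and each extends to a k-subset in
  \<open>(n - 2) choose (k - 2)\<close> ways.\<close>

lemma card_two_common:
  fixes S :: "nat set"
  assumes S: "S \<subseteq> {1..n}" "card S = k"
  shows "card {T. T \<subseteq> {1..n} \<and> card T = k \<and> 2 \<le> card (S \<inter> T)} \<le> k\<^sup>2 * ((n - 2) choose (k - 2))"
proof -
  have fS: "finite S" using S finite_subset by auto
  let ?D = "{p \<in> S \<times> S. fst p \<noteq> snd p}"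
  let ?F = "\<lambda>p. {T. T \<subseteq> {1..n} \<and> card T = k \<and> {fst p, snd p} \<subseteq> T}"
  have "{T. T \<subseteq> {1..n} \<and> card T = k \<and> 2 \<le> card (S \<inter> T)} \<subseteq> (\<Union>p\<in>?D. ?F p)"
  proof clarify
    fix T assume T: "T \<subseteq> {1..n}" "k = card T" "2 \<le> card (S \<inter> T)"
    then obtain a b where "a \<in> S \<inter> T" "b \<in> S \<inter> T" "a \<noteq> b"
      using card_le_Suc0_iff_eq[of "S \<inter> T"] fS by fastforce
    then show "T \<in> (\<Union>p\<in>{p \<in> S \<times> S. fst p \<noteq> snd p}. {T'. T' \<subseteq> {1..n} \<and> card T' = card T \<and> {fst p, snd p} \<subseteq> T'})"
      using T by (intro UN_I[of "(a, b)"]) auto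
  qed
  then have "card {T. T \<subseteq> {1..n} \<and> card T = k \<and> 2 \<le> card (S \<inter> T)} \<le> card (\<Union>p\<in>?D. ?F p)"
    using fS by (intro card_mono) auto
  also have "\<dots> \<le> (\<Sum>p\<in>?D. card (?F p))" using fS by (intro card_UN_le) auto
  also have "\<dots> = (\<Sum>p\<in>?D. (n - 2) choose (k - 2))"
  proof (intro sum.cong refl)
    fix p assume p: "p \<in> ?D"
    then have D: "{fst p, snd p} \<subseteq> S" "card {fst p, snd p} = 2" by auto
    then have "2 \<le> k" using S(2) fS card_mono by metis
    moreover have "{fst p, snd p} \<subseteq> {1..n}" using D(1) S(1) by (rule order_trans)
    ultimately show "card (?F p) = (n - 2) choose (k - 2)"
      using card_supersets[of "{1..n}" "{fst p, snd p}" k] by (simp only: D(2) finite_atLeastAtMost card_atLeastAtMost diff_Suc_1 Suc_eq_plus1 add_diff_cancel_right')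
  qed
  also have "\<dots> = card ?D * ((n - 2) choose (k - 2))" by simp
  also have "card ?D \<le> card (S \<times> S)" using fS by (intro card_mono) auto
  also have "card (S \<times> S) = k\<^sup>2" using S by (simp add: card_cartesian_product power2_eq_square)
  finally show ?thesis by simp
qed

section \<open>Orthogonality and the second moment of the remainder\<close>

context symmetric_kernel
begin

lemma U_decomposition: "U n \<omega> = (n choose k) * \<theta> + ((n - 1) choose (k - 1)) * H n \<omega> + R n \<omega>"
proof -
  have "R n \<omega> = U n \<omega> - (\<Sum>S | S \<subseteq> {1..n} \<and> card S = k. \<theta>) -
      (\<Sum>S | S \<subseteq> {1..n} \<and> card S = k. \<Sum>i\<in>S. h (\<omega> i) - \<theta>)"
    unfolding R_def U_def g_def sum_subtractf ..
  also have "(\<Sum>S | S \<subseteq> {1..n} \<and> card S = k. \<theta>) = (n choose k) * \<theta>"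
    by (simp add: n_subsets)
  also have "(\<Sum>S | S \<subseteq> {1..n} \<and> card S = k. \<Sum>i\<in>S. h (\<omega> i) - \<theta>) = ((n - 1) choose (k - 1)) * H n \<omega>"
    unfolding H_def using k_ge_2 by (intro sum_over_subsets) simp
  finally show ?thesis by simp
qed

lemma g_local:
  assumes "\<And>i. i \<in> S \<Longrightarrow> \<omega> i = \<omega>' i"
  shows "g S \<omega> = g S \<omega>'"
proof -
  have "(\<Sum>i\<in>S. h (\<omega> i) - \<theta>) = (\<Sum>i\<in>S. h (\<omega>' i) - \<theta>)"
    by (intro sum.cong refl) (simp only: assms)
  then show ?thesis using \<phi>_local[OF assms] by (simp only: g_def)
qed

lemma integral_g_g:
  assumes S: "finite S" "card S = k" and T: "finite T" and ST: "card (S \<inter> T) < 2"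
  shows "(\<integral>\<omega>. g S \<omega> * g T \<omega> \<partial>\<Omega>) = 0"
proof -
  \<comment> \<open>Keep the common index, or any index of \<open>S\<close> if there is none: the
    resampled coordinates \<open>S - {i}\<close> then miss \<open>T\<close>.\<close>
  have "\<exists>i\<in>S. S \<inter> T \<subseteq> {i}"
  proof (cases "S \<inter> T = {}")
    case True then show ?thesis using S k_ge_2 by fastforce
  next
    case False
    then have "card (S \<inter> T) = 1" using ST S(1) by (metis One_nat_def card_0_eq finite_Int less_2_cases)
    then show ?thesis by (metis card_1_singletonE Int_iff insertI1 order_refl)
  qed
  then obtain i where i: "i \<in> S" "S \<inter> T \<subseteq> {i}" by blast
  show ?thesis
  proof (rule integral_g_mult[OF S i(1) bm_g[OF T]])
    show "g T \<omega> = g T \<omega>'" if "\<And>j. j \<notin> S - {i} \<Longrightarrow> \<omega> j = \<omega>' j" for \<omega> \<omega>'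
      using that i(2) by (intro g_local) auto
  qed
qed

lemma integral_g:
  assumes "finite S" "card S = k"
  shows "(\<integral>\<omega>. g S \<omega> \<partial>\<Omega>) = 0"
proof -
  obtain i where "i \<in> S" using assms k_ge_2 by fastforce
  then show ?thesis
    using integral_g_mult[OF assms, of i "\<lambda>_. 1"] by (simp add: bounded_measurable_const)
qed

lemma integral_g_h:
  assumes S: "finite S" "card S = k"
  shows "(\<integral>\<omega>. g S \<omega> * (h (\<omega> i) - \<theta>) \<partial>\<Omega>) = 0"
proof -
  obtain l where "l \<in> S" using S k_ge_2 by fastforce
  \<comment> \<open>If \<open>i\<close> lies in \<open>S\<close>, it must be the index that is kept;
    otherwise any index of \<open>S\<close> does.\<close>
  then obtain j where j: "j \<in> S" "i \<in> S \<longrightarrow> j = i" by metis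
  show ?thesis
  proof (rule integral_g_mult[OF S j(1)])
    show "h (\<omega> i) - \<theta> = h (\<omega>' i) - \<theta>" if "\<And>l. l \<notin> S - {j} \<Longrightarrow> \<omega> l = \<omega>' l" for \<omega> \<omega>'
      using that[of i] j by auto
  qed (intro bounded_measurable_intros bm_h_component)
qed

lemma integral_H: "(\<integral>\<omega>. H n \<omega> \<partial>\<Omega>) = 0"
  unfolding H_def
  by (subst Bochner_Integration.integral_sum)
    (intro O.integrable_bounded_measurable bounded_measurable_intros bm_h_component,
     simp only: integral_centered sum.neutral_const)

lemma integral_R: "(\<integral>\<omega>. R n \<omega> \<partial>\<Omega>) = 0"
proof -
  have "(\<integral>\<omega>. R n \<omega> \<partial>\<Omega>) = (\<Sum>S | S \<subseteq> {1..n} \<and> card S = k. \<integral>\<omega>. g S \<omega> \<partial>\<Omega>)"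
    unfolding R_def
    by (rule Bochner_Integration.integral_sum)
      (intro O.integrable_bounded_measurable bm_g finite_subset_index)
  also have "\<dots> = 0"
    by (intro sum.neutral ballI integral_g finite_subset_index) auto
  finally show ?thesis .
qed

text \<open>Holds termwise by \<open>integral_g_h\<close>. It removes the cross term, so that the
  variance of \<open>U n\<close> is the sum of those of its linear part and of its
  remainder.\<close>

lemma integral_R_H: "(\<integral>\<omega>. R n \<omega> * H n \<omega> \<partial>\<Omega>) = 0"
proof -
  have "(\<integral>\<omega>. R n \<omega> * H n \<omega> \<partial>\<Omega>) =
      (\<Sum>S | S \<subseteq> {1..n} \<and> card S = k. \<integral>\<omega>. (\<Sum>i=1..n. g S \<omega> * (h (\<omega> i) - \<theta>)) \<partial>\<Omega>)"
    unfolding R_def H_def sum_product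
    by (rule Bochner_Integration.integral_sum)
      (intro O.integrable_bounded_measurable bounded_measurable_intros bm_h_component bm_g finite_subset_index)
  also have "\<dots> = (\<Sum>S | S \<subseteq> {1..n} \<and> card S = k. 0)"
  proof (intro sum.cong refl)
    fix S assume S: "S \<in> {S. S \<subseteq> {1..n} \<and> card S = k}"
    have "(\<integral>\<omega>. (\<Sum>i=1..n. g S \<omega> * (h (\<omega> i) - \<theta>)) \<partial>\<Omega>) = (\<Sum>i=1..n. \<integral>\<omega>. g S \<omega> * (h (\<omega> i) - \<theta>) \<partial>\<Omega>)"
      by (rule Bochner_Integration.integral_sum)
        (intro O.integrable_bounded_measurable bounded_measurable_intros bm_h_component bm_g finite_subset_index[OF S])
    also have "\<dots> = 0"
      using S by (intro sum.neutral ballI integral_g_h finite_subset_index[OF S]) auto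
    finally show "(\<integral>\<omega>. (\<Sum>i=1..n. g S \<omega> * (h (\<omega> i) - \<theta>)) \<partial>\<Omega>) = 0" .
  qed
  finally show ?thesis by simp
qed

lemma integral_H_squared: "(\<integral>\<omega>. (H n \<omega>)\<^sup>2 \<partial>\<Omega>) = n * \<sigma>2"
proof -
  have "(\<integral>\<omega>. (H n \<omega>)\<^sup>2 \<partial>\<Omega>) =
      (\<Sum>i=1..n. \<integral>\<omega>. (\<Sum>j=1..n. (h (\<omega> i) - \<theta>) * (h (\<omega> j) - \<theta>)) \<partial>\<Omega>)"
    unfolding H_def power2_eq_square sum_product
    by (rule Bochner_Integration.integral_sum)
      (intro O.integrable_bounded_measurable bounded_measurable_intros bm_h_component)
  also have "\<dots> = (\<Sum>i=1..n. \<Sum>j=1..n. \<integral>\<omega>. (h (\<omega> i) - \<theta>) * (h (\<omega> j) - \<theta>) \<partial>\<Omega>)"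
    by (intro sum.cong refl Bochner_Integration.integral_sum O.integrable_bounded_measurable
      bounded_measurable_intros bm_h_component)
  also have "\<dots> = (\<Sum>i=1..n. \<Sum>j=1..n. if j = i then \<sigma>2 else 0)"
  proof (intro sum.cong refl)
    fix i j :: nat
    show "(\<integral>\<omega>. (h (\<omega> i) - \<theta>) * (h (\<omega> j) - \<theta>) \<partial>\<Omega>) = (if j = i then \<sigma>2 else 0)"
    proof (cases "j = i")
      case True
      then show ?thesis
        using integral_component[of "\<lambda>z. (h z - \<theta>) * (h z - \<theta>)" i] bounded_measurableD[OF bm_h]
        by (simp add: \<sigma>2_def power2_eq_square)
    next
      case False
      then have "(\<integral>\<omega>. (h (\<omega> i) - \<theta>) * (h (\<omega> j) - \<theta>) \<partial>\<Omega>) = 0"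
      proof (intro integral_centered_mult)
        show "h (\<omega> j) - \<theta> = h (\<omega>' j) - \<theta>" if "\<And>l. l \<noteq> i \<Longrightarrow> \<omega> l = \<omega>' l" for \<omega> \<omega>'
          using that[OF False] by simp
      qed (intro bounded_measurable_intros bm_h_component)
      then show ?thesis using False by simp
    qed
  qed
  also have "\<dots> = n * \<sigma>2" by simp
  finally show ?thesis .
qed

text \<open>Only pairs with two common indices survive, each bounded by a constant. Their number is
  of order n^(2k-2), whereas the linear term has variance of order n^(2k-1) when
  \<open>\<sigma>2 > 0\<close>.\<close>

lemma integral_R_squared:
  "\<exists>C::real. \<forall>n. (\<integral>\<omega>. (R n \<omega>)\<^sup>2 \<partial>\<Omega>) \<le> C * ((n choose k) * (k\<^sup>2 * ((n - 2) choose (k - 2))))"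
proof -
  \<comment> \<open>A uniform bound for \<open>g\<close>: \<open>B\<close> for the kernel,
    \<open>\<bar>\<theta>\<bar>\<close> for the mean, and \<open>B + \<bar>\<theta>\<bar>\<close>
    for each of the \<open>k\<close> centred summands.\<close>
  define D where "D = B + \<bar>\<theta>\<bar> + k * (B + \<bar>\<theta>\<bar>)"
  have g: "\<bar>g S \<omega>\<bar> \<le> D" if "finite S" "card S = k" "\<omega> \<in> space \<Omega>" for S \<omega>
  proof -
    have "\<omega> i \<in> space N" for i using that(3) by (simp add: \<Omega>_def space_PiM PiE_iff)
    then have "\<bar>h (\<omega> i) - \<theta>\<bar> \<le> B + \<bar>\<theta>\<bar>" for i using h_bounded[of "\<omega> i"] by (simp add: abs_le_iff) linarith
    then have "(\<Sum>i\<in>S. \<bar>h (\<omega> i) - \<theta>\<bar>) \<le> (\<Sum>i\<in>S. B + \<bar>\<theta>\<bar>)" by (intro sum_mono) auto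
    then have "\<bar>\<Sum>i\<in>S. h (\<omega> i) - \<theta>\<bar> \<le> k * (B + \<bar>\<theta>\<bar>)"
      using that by (intro order_trans[OF sum_abs]) simp
    then show ?thesis unfolding g_def D_def using \<phi>_bounded[of S \<omega>] by linarith
  qed
  have pair: "(\<integral>\<omega>. g S \<omega> * g T \<omega> \<partial>\<Omega>) \<le> (if 2 \<le> card (S \<inter> T) then D\<^sup>2 else 0)"
    if S: "finite S" "card S = k" and T: "finite T" "card T = k" for S T
  proof (cases "2 \<le> card (S \<inter> T)")
    case True
    have "(\<integral>\<omega>. g S \<omega> * g T \<omega> \<partial>\<Omega>) \<le> (\<integral>\<omega>. D\<^sup>2 \<partial>\<Omega>)"
    proof (rule integral_mono)
      fix \<omega> assume "\<omega> \<in> space \<Omega>"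
      then have "\<bar>g S \<omega>\<bar> * \<bar>g T \<omega>\<bar> \<le> D * D" using g[OF S] g[OF T]
        by (intro mult_mono) (auto intro: order_trans[OF abs_ge_zero])
      then show "g S \<omega> * g T \<omega> \<le> D\<^sup>2" by (metis abs_le_D1 abs_mult power2_eq_square)
    qed (intro O.integrable_bounded_measurable bounded_measurable_intros bm_g S T)+
    then show ?thesis using True by (simp add: O.prob_space)
  qed (use integral_g_g[OF S T(1)] in simp)
  have "(\<integral>\<omega>. (R n \<omega>)\<^sup>2 \<partial>\<Omega>) \<le> D\<^sup>2 * ((n choose k) * (k\<^sup>2 * ((n - 2) choose (k - 2))))" for n
  proof -
    let ?I = "{S. S \<subseteq> {1..n} \<and> card S = k}"
    have fI: "finite ?I" by simp
    note fin = finite_subset_index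
    have "(\<integral>\<omega>. (R n \<omega>)\<^sup>2 \<partial>\<Omega>) = (\<Sum>S\<in>?I. \<integral>\<omega>. (\<Sum>T\<in>?I. g S \<omega> * g T \<omega>) \<partial>\<Omega>)"
      unfolding R_def power2_eq_square sum_product
      by (rule Bochner_Integration.integral_sum)
        (intro O.integrable_bounded_measurable bounded_measurable_intros bm_g fin)
    also have "\<dots> = (\<Sum>S\<in>?I. \<Sum>T\<in>?I. \<integral>\<omega>. g S \<omega> * g T \<omega> \<partial>\<Omega>)"
      by (intro sum.cong refl Bochner_Integration.integral_sum O.integrable_bounded_measurable
        bounded_measurable_intros bm_g fin)
    also have "\<dots> \<le> (\<Sum>S\<in>?I. \<Sum>T\<in>?I. if 2 \<le> card (S \<inter> T) then D\<^sup>2 else 0)"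
      by (intro sum_mono pair fin) auto
    also have "\<dots> \<le> (\<Sum>S\<in>?I. D\<^sup>2 * (k\<^sup>2 * ((n - 2) choose (k - 2))))"
    proof (rule sum_mono)
      fix S assume S: "S \<in> ?I"
      have I: "?I \<inter> {T. 2 \<le> card (S \<inter> T)} = {T. T \<subseteq> {1..n} \<and> card T = k \<and> 2 \<le> card (S \<inter> T)}" by auto
      have "(\<Sum>T\<in>?I. if 2 \<le> card (S \<inter> T) then D\<^sup>2 else 0)
          = card {T. T \<subseteq> {1..n} \<and> card T = k \<and> 2 \<le> card (S \<inter> T)} * D\<^sup>2"
        using fI by (simp only: sum.If_cases I sum.neutral_const sum_constant)
      also have "\<dots> \<le> real (k\<^sup>2 * ((n - 2) choose (k - 2))) * D\<^sup>2"
        using S by (intro mult_right_mono) (simp_all only: of_nat_le_iff card_two_common mem_Collect_eq zero_le_power2)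
      finally show "(\<Sum>T\<in>?I. if 2 \<le> card (S \<inter> T) then D\<^sup>2 else 0) \<le> D\<^sup>2 * (k\<^sup>2 * ((n - 2) choose (k - 2)))"
        by (simp add: mult.commute)
    qed
    also have "\<dots> = D\<^sup>2 * ((n choose k) * (k\<^sup>2 * ((n - 2) choose (k - 2))))"
      by (simp add: n_subsets mult_ac)
    finally show ?thesis .
  qed
  then show ?thesis by blast
qed

end

section \<open>Asymptotic normality of non-degenerate U-statistics\<close>

context symmetric_kernel
begin

text \<open>Shifted by \<open>Suc\<close> because the sample is indexed from 1, whereas the central
  limit theorem sums over \<open>i < n\<close>.\<close>

lemma indep_vars_components: "O.indep_vars (\<lambda>_. N) (\<lambda>i \<omega>. \<omega> (Suc i)) UNIV"
proof (subst O.indep_vars_iff_distr_eq_PiM')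
  have "distr \<Omega> N (\<lambda>\<omega>. \<omega> (Suc i)) = N" for i
    using distr_PiM_component[of UNIV "\<lambda>_. N" "Suc i"] N.prob_space_axioms by (simp add: \<Omega>_def)
  then show "distr \<Omega> (PiM UNIV (\<lambda>_. N)) (\<lambda>\<omega>. \<lambda>i\<in>UNIV. \<omega> (Suc i)) =
      PiM UNIV (\<lambda>i. distr \<Omega> N (\<lambda>\<omega>. \<omega> (Suc i)))"
    using distr_PiM_reindex[of UNIV "\<lambda>_. N" Suc UNIV] N.prob_space_axioms by (simp add: \<Omega>_def)
qed simp_all

lemma weak_conv_H:
  assumes "\<sigma>2 > 0"
  shows "weak_conv_m (\<lambda>n. distr \<Omega> borel (\<lambda>\<omega>. H n \<omega> / sqrt (n * \<sigma>2))) std_normal_distribution"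
proof -
  define X where "X i \<omega> = h (\<omega> (Suc i)) - \<theta>" for i and \<omega> :: "nat \<Rightarrow> 'b"
  have bm_X: "bounded_measurable \<Omega> (X i)" for i
    unfolding X_def by (intro bounded_measurable_intros bm_h_component)
  have [measurable]: "h \<in> borel_measurable N" by (rule bounded_measurableD[OF bm_h])
  have mean: "(\<integral>\<omega>. X i \<omega> \<partial>\<Omega>) = 0" for i unfolding X_def by (rule integral_centered)
  have "weak_conv_m (\<lambda>n. distr \<Omega> borel (\<lambda>\<omega>. (\<Sum>i<n. X i \<omega>) / sqrt (n * (sqrt \<sigma>2)\<^sup>2))) std_normal_distribution"
  proof (rule O.central_limit_theorem_zero_mean[where \<mu>="distr N borel (\<lambda>z. h z - \<theta>)", OF _ mean])
    show "O.indep_vars (\<lambda>_. borel) X UNIV"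
      unfolding X_def by (rule O.indep_vars_compose2[OF indep_vars_components]) measurable
    show "integrable \<Omega> (\<lambda>\<omega>. (X n \<omega>)\<^sup>2)" for n
      by (intro O.integrable_bounded_measurable bounded_measurable_intros bm_X)
    have "(\<integral>\<omega>. (X n \<omega>)\<^sup>2 \<partial>\<Omega>) = \<sigma>2" for n
      unfolding X_def \<sigma>2_def by (rule integral_component[of "\<lambda>z. (h z - \<theta>)\<^sup>2"]) measurable
    then show "O.variance (X n) = (sqrt \<sigma>2)\<^sup>2" for n using assms mean by simp
    have *: "distr \<Omega> N (\<lambda>\<omega>. \<omega> (Suc n)) = N" for n
      using distr_PiM_component[of UNIV "\<lambda>_. N" "Suc n"] N.prob_space_axioms by (simp add: \<Omega>_def)
    show "distr \<Omega> borel (X n) = distr N borel (\<lambda>z. h z - \<theta>)" for n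
      by (subst *[of n, symmetric], subst distr_distr) (simp_all add: comp_def X_def[abs_def])
  qed (use assms in simp)
  moreover have "(\<Sum>i<n. X i \<omega>) = H n \<omega>" for n \<omega>
    unfolding X_def H_def by (simp add: sum.atLeast1_atMost_eq)
  ultimately show ?thesis using assms by simp
qed

text \<open>The absorption identities \<open>k * b = n * c\<close> and
  \<open>(k - 1) * c = (n - 1) * d\<close> for the three binomial coefficients turn the bound on the
  second moment of \<open>R n\<close> into a multiple of \<open>c\<^sup>2 * n / (n - 1)\<close>, so
  that the quotient is an explicit O(1/n).\<close>

lemma remainder_ratio_tendsto_0:
  assumes "\<sigma>2 > 0"
  shows "(\<lambda>n. (\<integral>\<omega>. (R n \<omega>)\<^sup>2 \<partial>\<Omega>) / (((n - 1) choose (k - 1))\<^sup>2 * (n * \<sigma>2))) \<longlonglongrightarrow> 0"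
proof -
  obtain C :: real where
    C: "\<And>n. (\<integral>\<omega>. (R n \<omega>)\<^sup>2 \<partial>\<Omega>) \<le> C * ((n choose k) * (k\<^sup>2 * ((n - 2) choose (k - 2))))"
    using integral_R_squared by blast
  have bound: "norm ((\<integral>\<omega>. (R n \<omega>)\<^sup>2 \<partial>\<Omega>) / (((n - 1) choose (k - 1))\<^sup>2 * (n * \<sigma>2)))
      \<le> C * k * (k - 1) / \<sigma>2 / (real n - 1)" if n: "n \<ge> k" for n
  proof -
    define c where "c = real ((n - 1) choose (k - 1))"
    define d where "d = real ((n - 2) choose (k - 2))"
    define b where "b = real (n choose k)"
    have n2: "n \<ge> 2" using n k_ge_2 by simp
    have c: "c > 0" unfolding c_def using n by (simp add: zero_less_binomial_iff)
    have "k * (n choose k) = n * ((n - 1) choose (k - 1))"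
      using k_ge_2 by (intro times_binomial_minus1_eq) simp
    then have 1: "k * b = n * c" unfolding b_def c_def by (metis of_nat_mult)
    have "(k - 1) * ((n - 1) choose (k - 1)) = (n - 1) * ((n - 1 - 1) choose (k - 1 - 1))"
      using k_ge_2 by (intro times_binomial_minus1_eq) simp
    then have 2: "(real k - 1) * c = (real n - 1) * d"
      unfolding c_def d_def using n2 k_ge_2
      by (metis (no_types, lifting) One_nat_def Suc_1 Suc_leD diff_diff_left of_nat_1 of_nat_diff of_nat_mult plus_1_eq_Suc)
    have "(\<integral>\<omega>. (R n \<omega>)\<^sup>2 \<partial>\<Omega>) \<le> C * (k * b) * k * d"
      using C[of n] by (simp add: b_def d_def power2_eq_square mult_ac)
    also have "\<dots> = C * k * (real k - 1) / \<sigma>2 / (real n - 1) * (c\<^sup>2 * (n * \<sigma>2))"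
    proof -
      have "d = (real k - 1) * c / (real n - 1)" using 2 n2 by (simp add: field_simps)
      then show ?thesis unfolding 1 using assms by (simp add: power2_eq_square)
    qed
    finally have "(\<integral>\<omega>. (R n \<omega>)\<^sup>2 \<partial>\<Omega>) / (c\<^sup>2 * (n * \<sigma>2)) \<le> C * k * (real k - 1) / \<sigma>2 / (real n - 1)"
      using c n2 assms by (subst pos_divide_le_eq) (simp_all add: mult_ac)
    moreover have "(\<integral>\<omega>. (R n \<omega>)\<^sup>2 \<partial>\<Omega>) \<ge> 0" by simp
    ultimately show ?thesis using assms k_ge_2 by (simp add: c_def of_nat_diff)
  qed
  show ?thesis
  proof (rule Lim_null_comparison)
    show "\<forall>\<^sub>F n in sequentially. norm ((\<integral>\<omega>. (R n \<omega>)\<^sup>2 \<partial>\<Omega>) / (((n - 1) choose (k - 1))\<^sup>2 * (n * \<sigma>2)))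
      \<le> C * k * (k - 1) / \<sigma>2 / (real n - 1)"
      by (rule eventually_mono[OF eventually_ge_at_top[of k] bound])
    show "(\<lambda>n. C * k * (k - 1) / \<sigma>2 / (real n - 1)) \<longlonglongrightarrow> 0"
      using filterlim_tendsto_add_at_top[OF tendsto_const[of "- 1 :: real"] filterlim_real_sequentially]
      by (intro real_tendsto_divide_at_top[OF tendsto_const]) simp
  qed
qed

lemma weak_conv_U:
  assumes "\<sigma>2 > 0"
  shows "weak_conv_m (\<lambda>n. distr \<Omega> borel (\<lambda>\<omega>. (U n \<omega> - O.expectation (U n)) / sqrt (O.variance (U n))))
    std_normal_distribution"
proof (rule O.weak_conv_m_L2_perturbation[OF _ _ weak_conv_H[OF assms]])
  let ?B = "\<lambda>n \<omega>. (U n \<omega> - O.expectation (U n)) / sqrt (O.variance (U n))"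
  define c where "c n = real ((n - 1) choose (k - 1))" for n
  define \<rho> where "\<rho> n = (\<integral>\<omega>. (R n \<omega>)\<^sup>2 \<partial>\<Omega>)" for n
  \<comment> \<open>The variance of the remainder relative to that of the linear term: the exact
    variance of \<open>U n\<close> is the latter times \<open>1 + r n\<close>.\<close>
  define r where "r n = \<rho> n / ((c n)\<^sup>2 * (n * \<sigma>2))" for n
  note int = O.integrable_bounded_measurable
  note bm = bounded_measurable_intros bm_H bm_R
  have r: "r \<longlonglongrightarrow> 0"
    using remainder_ratio_tendsto_0[OF assms] unfolding r_def[abs_def] \<rho>_def c_def by simp
  \<comment> \<open>Pythagoras for the orthogonal pair \<open>H n\<close>, \<open>R n\<close>; it
    yields both the exact variance and the mean square distance below.\<close>
  have lin: "(\<integral>\<omega>. (a * H n \<omega> + b * R n \<omega>)\<^sup>2 \<partial>\<Omega>) = a\<^sup>2 * (n * \<sigma>2) + b\<^sup>2 * \<rho> n" for a b n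
  proof -
    have "(a * H n \<omega> + b * R n \<omega>)\<^sup>2 = a\<^sup>2 * (H n \<omega>)\<^sup>2 + b\<^sup>2 * (R n \<omega>)\<^sup>2 + 2 * a * b * (R n \<omega> * H n \<omega>)" for \<omega>
      by (simp add: power2_sum power_mult_distrib)
    moreover have "integrable \<Omega> (\<lambda>\<omega>. (H n \<omega>)\<^sup>2)" "integrable \<Omega> (\<lambda>\<omega>. (R n \<omega>)\<^sup>2)" "integrable \<Omega> (\<lambda>\<omega>. R n \<omega> * H n \<omega>)"
      by (intro int bm)+
    ultimately show ?thesis by (simp add: integral_H_squared integral_R_H \<rho>_def)
  qed
  have mean: "O.expectation (U n) = (n choose k) * \<theta>" for n
    unfolding U_decomposition
    using int[OF bm_H[of n]] int[OF bm_R[of n]] by (simp add: integral_H integral_R O.prob_space)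
  have var: "O.variance (U n) = (c n)\<^sup>2 * (n * \<sigma>2) + \<rho> n" for n
    using lin[of "c n" n 1] unfolding mean U_decomposition by (simp add: c_def)
  \<comment> \<open>The first summand is the error from rescaling \<open>H n\<close> to the exact
    variance, the second comes from \<open>R n\<close>. For \<open>n \<ge> k\<close> the binomial
    coefficient \<open>c n\<close> is nonzero.\<close>
  have eq: "(\<integral>\<omega>. (H n \<omega> / sqrt (n * \<sigma>2) - ?B n \<omega>)\<^sup>2 \<partial>\<Omega>) = (1 - 1 / sqrt (1 + r n))\<^sup>2 + r n / (1 + r n)"
    if n: "n \<ge> k" for n
  proof -
    have c: "c n > 0" unfolding c_def using n by (simp add: zero_less_binomial_iff)
    have n\<sigma>: "n * \<sigma>2 > 0" using n k_ge_2 assms by simp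
    have \<rho>: "\<rho> n \<ge> 0" unfolding \<rho>_def by simp
    have r0: "r n \<ge> 0" unfolding r_def using \<rho> n\<sigma> by (intro divide_nonneg_nonneg mult_nonneg_nonneg) (use assms in simp_all)
    have "(c n)\<^sup>2 * (n * \<sigma>2) \<noteq> 0" using c n\<sigma> by (metis less_irrefl mult_pos_pos zero_less_power)
    then have \<rho>_eq: "\<rho> n = (c n)\<^sup>2 * (n * \<sigma>2) * r n"
      using nonzero_mult_div_cancel_left[of _ "\<rho> n"] unfolding r_def by (metis times_divide_eq_right)
    have var': "O.variance (U n) = (c n)\<^sup>2 * (n * \<sigma>2) * (1 + r n)" unfolding var \<rho>_eq by (simp add: algebra_simps)
    then have sq: "sqrt (O.variance (U n)) = c n * sqrt (n * \<sigma>2) * sqrt (1 + r n)"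
      using c by (simp only: real_sqrt_mult real_sqrt_abs abs_of_pos)
    have U: "U n \<omega> - O.expectation (U n) = c n * H n \<omega> + R n \<omega>" for \<omega>
      unfolding mean U_decomposition by (simp add: c_def)
    have B: "?B n \<omega> = (c n * H n \<omega> + R n \<omega>) / (c n * sqrt (n * \<sigma>2) * sqrt (1 + r n))" for \<omega>
      unfolding sq unfolding U ..
    define s where "s = sqrt (n * \<sigma>2)"
    define t where "t = sqrt (1 + r n)"
    have s: "s > 0" "s\<^sup>2 = n * \<sigma>2" and t: "t > 0" "t\<^sup>2 = 1 + r n"
      using n\<sigma> r0 unfolding s_def t_def by auto
    have "(\<integral>\<omega>. (H n \<omega> / sqrt (n * \<sigma>2) - ?B n \<omega>)\<^sup>2 \<partial>\<Omega>)
        = (\<integral>\<omega>. ((1 / s - 1 / (s * t)) * H n \<omega> + (- 1 / (c n * s * t)) * R n \<omega>)\<^sup>2 \<partial>\<Omega>)"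
      unfolding B s_def[symmetric] t_def[symmetric]
      using c s(1) t(1) by (intro Bochner_Integration.integral_cong refl arg_cong[where f="\<lambda>x. x\<^sup>2"]) (simp add: field_simps)
    also have "\<dots> = (1 / s - 1 / (s * t))\<^sup>2 * s\<^sup>2 + (- 1 / (c n * s * t))\<^sup>2 * ((c n)\<^sup>2 * s\<^sup>2 * r n)"
      unfolding lin \<rho>_eq s(2) ..
    also have "(1 / s - 1 / (s * t))\<^sup>2 * s\<^sup>2 = (1 - 1 / t)\<^sup>2"
      using s(1) t(1) by (simp add: power2_eq_square field_simps)
    also have "(- 1 / (c n * s * t))\<^sup>2 * ((c n)\<^sup>2 * s\<^sup>2 * r n) = r n / t\<^sup>2"
      using c s(1) t(1) by (simp add: power2_eq_square)
    finally show ?thesis unfolding t(2) unfolding t_def .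
  qed
  have "(\<lambda>n. (1 - 1 / sqrt (1 + r n))\<^sup>2 + r n / (1 + r n)) \<longlonglongrightarrow> (1 - 1 / sqrt (1 + 0))\<^sup>2 + 0 / (1 + 0)"
    by (intro tendsto_intros r) simp_all
  then have "(\<lambda>n. (1 - 1 / sqrt (1 + r n))\<^sup>2 + r n / (1 + r n)) \<longlonglongrightarrow> 0" by simp
  then show "(\<lambda>n. \<integral>\<omega>. (H n \<omega> / sqrt (n * \<sigma>2) - ?B n \<omega>)\<^sup>2 \<partial>\<Omega>) \<longlonglongrightarrow> 0"
    by (rule Lim_transform_eventually)
      (use eventually_ge_at_top[of k] in \<open>rule eventually_mono\<close>, rule eq[symmetric])
  show "bounded_measurable \<Omega> (\<lambda>\<omega>. H n \<omega> / sqrt (n * \<sigma>2))" "bounded_measurable \<Omega> (?B n)" for n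
    by (intro bm bm_U)+
  show "real_distribution std_normal_distribution" by (rule real_dist_normal_dist)
qed

end

section \<open>Patterns formed by points in the unit square\<close>

text \<open>The enumeration \<open>e\<close> lists the points with indices in \<open>S\<close> by increasing abscissa.\<close>

definition forms_pattern :: "nat \<Rightarrow> (nat \<Rightarrow> nat) \<Rightarrow> nat set \<Rightarrow> (nat \<Rightarrow> real \<times> real) \<Rightarrow> bool" where
  "forms_pattern k q S \<omega> \<longleftrightarrow> (\<exists>e. bij_betw e {1..k} S \<and>
     (\<forall>j\<in>{1..k}. \<forall>r\<in>{1..k}. (j < r \<longleftrightarrow> fst (\<omega> (e j)) < fst (\<omega> (e r))) \<and>
        (q j < q r \<longleftrightarrow> snd (\<omega> (e j)) < snd (\<omega> (e r)))))"

definition unif :: "real measure" where "unif = uniform_measure lborel {0..1}"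

interpretation unif: prob_space unif
  unfolding unif_def by (rule prob_space_uniform_measure) simp_all

interpretation unif2: pair_prob_space unif unif ..

lemma sets_unif [simp]: "sets unif = sets borel"
  by (simp add: unif_def)

lemma space_unif [simp]: "space unif = UNIV"
  by (simp add: unif_def)

lemma measurable_unif [simp]: "measurable unif M = measurable borel M"
  by (rule measurable_cong_sets[OF sets_unif refl])

lemma measure_unif: "A \<in> sets borel \<Longrightarrow> measure unif A = measure lborel ({0..1} \<inter> A)"
  unfolding unif_def by (subst measure_uniform_measure) simp_all

lemma forms_pattern_local:
  assumes "\<And>i. i \<in> S \<Longrightarrow> \<omega> i = \<omega>' i"
  shows "forms_pattern k q S \<omega> = forms_pattern k q S \<omega>'"
proof -
  have "\<omega> (e j) = \<omega>' (e j)" if "bij_betw e {1..k} S" "j \<in> {1..k}" for e j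
    using that assms bij_betwE by metis
  then show ?thesis unfolding forms_pattern_def
    by (intro ex_cong1 conj_cong refl ball_cong) simp_all
qed

lemma forms_pattern_image:
  assumes "inj \<sigma>"
  shows "forms_pattern k q (\<sigma> ` S) \<omega> = forms_pattern k q S (\<omega> \<circ> \<sigma>)"
proof
  assume "forms_pattern k q (\<sigma> ` S) \<omega>"
  then obtain e where e: "bij_betw e {1..k} (\<sigma> ` S)"
    and P: "\<forall>j\<in>{1..k}. \<forall>r\<in>{1..k}. (j < r \<longleftrightarrow> fst (\<omega> (e j)) < fst (\<omega> (e r))) \<and>
        (q j < q r \<longleftrightarrow> snd (\<omega> (e j)) < snd (\<omega> (e r)))"
    unfolding forms_pattern_def by blast
  have "\<sigma> (inv \<sigma> (e j)) = e j" if "j \<in> {1..k}" for j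
    using bij_betwE[OF e] that assms by (metis imageE inv_f_f)
  moreover have "bij_betw (inv \<sigma>) (\<sigma> ` S) S"
    using assms by (simp add: bij_betw_def inj_on_inv_into image_inv_f_f image_comp)
       (metis inj_on_inv_into subset_UNIV image_mono)
  then have "bij_betw (inv \<sigma> \<circ> e) {1..k} S" using e by (rule bij_betw_trans[rotated])
  ultimately show "forms_pattern k q S (\<omega> \<circ> \<sigma>)"
    unfolding forms_pattern_def using P by (intro exI[of _ "inv \<sigma> \<circ> e"]) simp
next
  assume "forms_pattern k q S (\<omega> \<circ> \<sigma>)"
  then obtain e where e: "bij_betw e {1..k} S"
    and P: "\<forall>j\<in>{1..k}. \<forall>r\<in>{1..k}. (j < r \<longleftrightarrow> fst (\<omega> (\<sigma> (e j))) < fst (\<omega> (\<sigma> (e r)))) \<and>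
        (q j < q r \<longleftrightarrow> snd (\<omega> (\<sigma> (e j))) < snd (\<omega> (\<sigma> (e r))))"
    unfolding forms_pattern_def comp_def by blast
  have "bij_betw \<sigma> S (\<sigma> ` S)" using assms by (meson inj_on_imp_bij_betw inj_on_subset subset_UNIV)
  with e have "bij_betw (\<sigma> \<circ> e) {1..k} (\<sigma> ` S)" by (rule bij_betw_trans)
  then show "forms_pattern k q (\<sigma> ` S) \<omega>"
    unfolding forms_pattern_def using P by (intro exI[of _ "\<sigma> \<circ> e"]) simp
qed

lemma forms_pattern_card: "forms_pattern k q S \<omega> \<Longrightarrow> card S = k"
  unfolding forms_pattern_def by (auto dest: bij_betw_same_card)

text \<open>The existential ranges over uncountably many functions \<open>e\<close>, but only their
  values on \<open>{1..k}\<close> matter; cut down to extensional functions into \<open>S\<close> it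
  becomes a finite union.\<close>

lemma measurable_forms_pattern:
  assumes "finite S"
  shows "Measurable.pred (PiM UNIV (\<lambda>_. unif \<Otimes>\<^sub>M unif)) (forms_pattern k q S)"
proof -
  let ?M = "PiM UNIV (\<lambda>_::nat. unif \<Otimes>\<^sub>M unif)"
  let ?E = "{e \<in> {1..k} \<rightarrow>\<^sub>E S. bij_betw e {1..k} S}"
  have fin: "finite ?E" using assms by (simp add: finite_PiE)
  have eq: "forms_pattern k q S \<omega> \<longleftrightarrow> (\<exists>e\<in>?E. \<forall>j\<in>{1..k}. \<forall>r\<in>{1..k}.
      (j < r \<longleftrightarrow> fst (\<omega> (e j)) < fst (\<omega> (e r))) \<and> (q j < q r \<longleftrightarrow> snd (\<omega> (e j)) < snd (\<omega> (e r))))"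
    (is "_ \<longleftrightarrow> (\<exists>e\<in>?E. ?P e)") for \<omega> :: "nat \<Rightarrow> real \<times> real"
  proof
    assume "forms_pattern k q S \<omega>"
    then obtain e where e: "bij_betw e {1..k} S" "?P e" unfolding forms_pattern_def by blast
    have "bij_betw (restrict e {1..k}) {1..k} S" using e(1) by (simp add: bij_betw_restrict_eq)
    moreover have "restrict e {1..k} \<in> {1..k} \<rightarrow>\<^sub>E S" using bij_betwE[OF e(1)] by auto
    moreover have "?P (restrict e {1..k})" using e(2) by simp
    ultimately show "\<exists>e\<in>?E. ?P e" by blast
  qed (auto simp: forms_pattern_def)
  have [measurable]: "(\<lambda>\<omega>. fst (\<omega> i)) \<in> borel_measurable ?M" "(\<lambda>\<omega>. snd (\<omega> i)) \<in> borel_measurable ?M" for i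
    using measurable_compose[OF measurable_component_singleton[of i UNIV "\<lambda>_. unif \<Otimes>\<^sub>M unif"] measurable_fst]
      measurable_compose[OF measurable_component_singleton[of i UNIV "\<lambda>_. unif \<Otimes>\<^sub>M unif"] measurable_snd]
    by (simp_all add: measurable_cong_sets[OF refl sets_unif])
  show ?thesis unfolding eq[abs_def]
    by (intro pred_intros_finite(4)[OF fin]) measurable
qed

lemma symmetric_kernel_forms_pattern:
  assumes "k \<ge> 2"
  shows "symmetric_kernel (unif \<Otimes>\<^sub>M unif) k (\<lambda>S \<omega>. of_bool (forms_pattern k q S \<omega>)) 1"
proof (intro symmetric_kernel.intro symmetric_kernel_axioms.intro assms)
  show "prob_space (unif \<Otimes>\<^sub>M unif)" by (rule unif2.prob_space_axioms)
  show "(\<lambda>\<omega>. of_bool (forms_pattern k q S \<omega>) :: real) \<in> borel_measurable (PiM UNIV (\<lambda>_. unif \<Otimes>\<^sub>M unif))"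
    if "finite S" for S
    using measurable_forms_pattern[OF that] by measurable
  show "(of_bool (forms_pattern k q S \<omega>) :: real) = of_bool (forms_pattern k q S \<omega>')"
    if "\<And>i. i \<in> S \<Longrightarrow> \<omega> i = \<omega>' i" for S \<omega> \<omega>'
    using forms_pattern_local[of S \<omega> \<omega>' k q] that by presburger
qed (simp_all add: forms_pattern_image)

section \<open>Ranks: from points to permutations\<close>

text \<open>The rank, that is the number of \<open>j\<close> with \<open>u j \<le> u i\<close>,
  preserves the order. It is thus an injection of the finite set \<open>{1..n}\<close> into itself,
  hence a bijection; it is extended by the identity.\<close>

lemma rank_permutation:
  fixes u :: "nat \<Rightarrow> real"
  assumes "inj_on u {1..n}"
  shows "\<exists>a. a permutes {1..n} \<and> (\<forall>i\<in>{1..n}. \<forall>j\<in>{1..n}. a i < a j \<longleftrightarrow> u i < u j)"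
proof -
  define R where "R i = {j \<in> {1..n}. u j \<le> u i}" for i
  define a where "a i = (if i \<in> {1..n} then card (R i) else i)" for i
  have fin: "finite (R i)" for i unfolding R_def by simp
  have mono: "a i < a j" if "i \<in> {1..n}" "j \<in> {1..n}" "u i < u j" for i j
  proof -
    have "R i \<subseteq> R j" "j \<in> R j" "j \<notin> R i" using that by (auto simp: R_def)
    then have "R i \<subset> R j" by blast
    then show ?thesis using that fin by (simp add: a_def psubset_card_mono)
  qed
  have iff: "a i < a j \<longleftrightarrow> u i < u j" if "i \<in> {1..n}" "j \<in> {1..n}" for i j
    using mono[OF that] mono[OF that(2,1)] by (metis less_irrefl less_asym linorder_cases inj_onD[OF assms] that)
  have inj: "inj_on a {1..n}"
    using iff by (intro inj_onI) (metis assms inj_onD linorder_less_linear less_irrefl)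
  have "a ` {1..n} \<subseteq> {1..n}"
  proof clarify
    fix i assume i: "i \<in> {1..n}"
    then have "i \<in> R i" "R i \<subseteq> {1..n}" unfolding R_def by auto
    then have "card (R i) \<ge> 1" "card (R i) \<le> n"
      using fin[of i] card_mono[of "{1..n}" "R i"] by (auto simp: Suc_le_eq card_gt_0_iff)
    then show "a i \<in> {1..n}" using i by (simp add: a_def)
  qed
  with inj have "bij_betw a {1..n} {1..n}"
    by (metis bij_betw_def endo_inj_surj finite_atLeastAtMost)
  then have "a permutes {1..n}" by (rule bij_imp_permutes) (auto simp: a_def)
  with iff show ?thesis by blast
qed

text \<open>The point with index \<open>i\<close> stands at position \<open>a i\<close> from the
  left, and its ordinate \<open>v (\<sigma> i)\<close> has rank \<open>b (\<sigma> i)\<close>, so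
  the permutation read off is \<open>b \<circ> \<sigma> \<circ> inv a\<close>. An enumeration
  \<open>e\<close> of the points corresponds to the list \<open>a \<circ> e\<close> of
  positions.\<close>

lemma pattern_occurrence_rank_image:
  assumes a: "a permutes {1..n}" "\<forall>i\<in>{1..n}. \<forall>j\<in>{1..n}. a i < a j \<longleftrightarrow> u i < u j"
    and b: "\<forall>i\<in>{1..n}. \<forall>j\<in>{1..n}. b i < b j \<longleftrightarrow> v i < v j"
    and \<sigma>: "\<sigma> permutes {1..n}" and S: "S \<subseteq> {1..n}"
  shows "pattern_occurrence k q n (b \<circ> \<sigma> \<circ> inv a) (a ` S) \<longleftrightarrow>
    forms_pattern k q S (\<lambda>i. (u i, v (\<sigma> i) :: real))"
proof
  assume "pattern_occurrence k q n (b \<circ> \<sigma> \<circ> inv a) (a ` S)"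
  then obtain i where i: "strict_mono_on {1..k} i" "i ` {1..k} = a ` S"
    and P: "\<forall>j\<in>{1..k}. \<forall>r\<in>{1..k}. q j < q r \<longleftrightarrow> b (\<sigma> (inv a (i j))) < b (\<sigma> (inv a (i r)))"
    unfolding pattern_occurrence_def by auto
  define e where "e = inv a \<circ> i"
  have ae: "a (e j) = i j" for j unfolding e_def using a(1) by (simp add: permutes_inverses)
  have "inj_on i {1..k}" using i(1) by (rule strict_mono_on_imp_inj_on)
  moreover have "e ` {1..k} = S"
    unfolding e_def image_comp[symmetric] i(2) using permutes_inverses(2)[OF a(1)] by (simp add: image_comp)
  ultimately have e: "bij_betw e {1..k} S"
    unfolding bij_betw_def e_def using permutes_inj[OF permutes_inv[OF a(1)]]
    by (simp add: comp_inj_on inj_on_subset)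
  have en: "e j \<in> {1..n}" if "j \<in> {1..k}" for j using bij_betwE[OF e] that S by blast
  have \<sigma>n: "\<sigma> (e j) \<in> {1..n}" if "j \<in> {1..k}" for j using en[OF that] permutes_in_image[OF \<sigma>] by blast
  have "(j < r \<longleftrightarrow> u (e j) < u (e r)) \<and> (q j < q r \<longleftrightarrow> v (\<sigma> (e j)) < v (\<sigma> (e r)))"
    if j: "j \<in> {1..k}" and r: "r \<in> {1..k}" for j r
  proof
    have "u (e j) < u (e r) \<longleftrightarrow> i j < i r" using a(2) en[OF j] en[OF r] ae by metis
    then show "j < r \<longleftrightarrow> u (e j) < u (e r)" using strict_mono_on_less[OF i(1) j r] by simp
    show "q j < q r \<longleftrightarrow> v (\<sigma> (e j)) < v (\<sigma> (e r))"
      using P j r b \<sigma>n[OF j] \<sigma>n[OF r] unfolding e_def by simp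
  qed
  with e show "forms_pattern k q S (\<lambda>i. (u i, v (\<sigma> i)))"
    unfolding forms_pattern_def by auto
next
  assume "forms_pattern k q S (\<lambda>i. (u i, v (\<sigma> i)))"
  then obtain e where e: "bij_betw e {1..k} S"
    and P: "\<forall>j\<in>{1..k}. \<forall>r\<in>{1..k}. (j < r \<longleftrightarrow> u (e j) < u (e r)) \<and> (q j < q r \<longleftrightarrow> v (\<sigma> (e j)) < v (\<sigma> (e r)))"
    unfolding forms_pattern_def by auto
  have en: "e j \<in> {1..n}" if "j \<in> {1..k}" for j using bij_betwE[OF e] that S by blast
  have \<sigma>n: "\<sigma> (e j) \<in> {1..n}" if "j \<in> {1..k}" for j using en[OF that] permutes_in_image[OF \<sigma>] by blast
  have "strict_mono_on {1..k} (a \<circ> e)"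
  proof (rule strict_mono_onI)
    fix r s assume "r \<in> {1..k}" "s \<in> {1..k}" "r < s"
    then have "u (e r) < u (e s)" "e r \<in> {1..n}" "e s \<in> {1..n}" using P en by blast+
    then show "(a \<circ> e) r < (a \<circ> e) s" using a(2) by simp
  qed
  moreover have "(a \<circ> e) ` {1..k} = a ` S" using bij_betw_imp_surj_on[OF e] by (simp only: image_comp[symmetric])
  moreover have "a ` S \<subseteq> {1..n}" using S permutes_in_image[OF a(1)] by auto
  moreover have "q j < q r \<longleftrightarrow> (b \<circ> \<sigma> \<circ> inv a) ((a \<circ> e) j) < (b \<circ> \<sigma> \<circ> inv a) ((a \<circ> e) r)"
    if "j \<in> {1..k}" "r \<in> {1..k}" for j r
    using that P b \<sigma>n permutes_inverses(2)[OF a(1)] by simp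
  ultimately show "pattern_occurrence k q n (b \<circ> \<sigma> \<circ> inv a) (a ` S)"
    unfolding pattern_occurrence_def by blast
qed

text \<open>Taking images under \<open>a\<close> matches sets of point indices with sets of
  positions. A set that forms the pattern has \<open>k\<close> elements, so nothing is lost in
  summing over k-subsets only.\<close>

lemma num_occurrences_rank:
  assumes a: "a permutes {1..n}" "\<forall>i\<in>{1..n}. \<forall>j\<in>{1..n}. a i < a j \<longleftrightarrow> u i < u j"
    and b: "\<forall>i\<in>{1..n}. \<forall>j\<in>{1..n}. b i < b j \<longleftrightarrow> v i < v j"
    and \<sigma>: "\<sigma> permutes {1..n}"
  shows "real (num_occurrences k q n (b \<circ> \<sigma> \<circ> inv a)) =
    (\<Sum>S | S \<subseteq> {1..n} \<and> card S = k. of_bool (forms_pattern k q S (\<lambda>i. (u i, v (\<sigma> i)))))"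
proof -
  let ?p = "b \<circ> \<sigma> \<circ> inv a" and ?F = "\<lambda>S. forms_pattern k q S (\<lambda>i. (u i, v (\<sigma> i)))"
  note iff = pattern_occurrence_rank_image[OF a b \<sigma>]
  have "{S. pattern_occurrence k q n ?p S} = (`) a ` {S. S \<subseteq> {1..n} \<and> ?F S}" (is "?L = ?R")
  proof
    show "?L \<subseteq> ?R"
    proof
      fix S assume "S \<in> ?L"
      then have S: "S \<subseteq> {1..n}" "pattern_occurrence k q n ?p S" by (simp_all add: pattern_occurrence_def)
      have eq: "a ` (inv a ` S) = S" using permutes_inverses(1)[OF a(1)] by (simp add: image_comp)
      have sub: "inv a ` S \<subseteq> {1..n}" using S(1) permutes_in_image[OF permutes_inv[OF a(1)]] by auto
      have "?F (inv a ` S)" using iff[OF sub] S(2) by (simp only: eq)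
      then show "S \<in> ?R" using eq sub by blast
    qed
    show "?R \<subseteq> ?L" using iff by blast
  qed
  then have "num_occurrences k q n ?p = card ((`) a ` {S. S \<subseteq> {1..n} \<and> ?F S})"
    unfolding num_occurrences_def by simp
  also have "\<dots> = card {S. S \<subseteq> {1..n} \<and> ?F S}"
    using permutes_inj[OF a(1)] by (intro card_image) (meson inj_image_eq_iff inj_onI)
  also have "{S. S \<subseteq> {1..n} \<and> ?F S} = {S. S \<subseteq> {1..n} \<and> card S = k} \<inter> {S. ?F S}"
    using forms_pattern_card by blast
  finally show ?thesis
    by (simp add: sum.If_cases of_bool_def comp_def)
qed

section \<open>Random points and random permutations\<close>

abbreviation coords :: "(nat \<times> bool \<Rightarrow> real) measure" where
  "coords \<equiv> PiM UNIV (\<lambda>_. unif)"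

text \<open>Coordinate \<open>(i, False)\<close> is the abscissa and \<open>(i, True)\<close> the ordinate of the \<open>i\<close>-th point.\<close>

definition points :: "(nat \<times> bool \<Rightarrow> real) \<Rightarrow> nat \<Rightarrow> real \<times> real" where
  "points x i = (x (i, False), x (i, True))"

interpretation coords: product_prob_space "\<lambda>_ :: nat \<times> bool. unif" UNIV
  by unfold_locales

lemma coord_measurable [measurable]: "(\<lambda>x. x i) \<in> coords \<rightarrow>\<^sub>M unif" 
  by simp

lemma coord_borel [measurable]: "(\<lambda>x. x i) \<in> borel_measurable coords"
  using coord_measurable[of i] by (simp add: measurable_cong_sets[OF refl sets_unif])

lemma shuffle_measurable [measurable]:
  "(\<lambda>x i. (x (i, False), x (\<sigma> i, True))) \<in> coords \<rightarrow>\<^sub>M PiM UNIV (\<lambda>_::nat. unif \<Otimes>\<^sub>M unif)"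
proof (rule measurable_PiM_single')
  show "(\<lambda>x. (x (i, False), x (\<sigma> i, True))) \<in> coords \<rightarrow>\<^sub>M unif \<Otimes>\<^sub>M unif" for i
    by (intro measurable_Pair coord_measurable)
qed (simp add: space_pair_measure)

lemma points_measurable [measurable]: "points \<in> coords \<rightarrow>\<^sub>M PiM UNIV (\<lambda>_. unif \<Otimes>\<^sub>M unif)"
  unfolding points_def[abs_def] by (rule shuffle_measurable)

lemma distr_coord: "distr coords unif (\<lambda>x. x i) = unif"
  by (rule distr_PiM_component) (simp_all add: unif.prob_space_axioms)

lemma indep_coords: "coords.indep_vars (\<lambda>_. unif) (\<lambda>i x. x i) UNIV"
  by (subst coords.indep_vars_iff_distr_eq_PiM') (simp_all add: distr_coord restrict_def)

text \<open>Distinct points read disjoint blocks of independent coordinates, and within a block the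
  two coordinates are independent and uniform.\<close>

lemma distr_points: "distr coords (PiM UNIV (\<lambda>_. unif \<Otimes>\<^sub>M unif)) points = PiM UNIV (\<lambda>_. unif \<Otimes>\<^sub>M unif)"
proof -
  have 1: "coords.indep_vars (\<lambda>i. PiM ({i} \<times> UNIV) (\<lambda>_. unif)) (\<lambda>i x. restrict x ({i} \<times> UNIV)) (UNIV :: nat set)"
    using coords.indep_vars_restrict[OF indep_coords, of UNIV "\<lambda>i. {i} \<times> UNIV"]
    by (auto simp: disjoint_family_on_def)
  have "coords.indep_vars (\<lambda>_. unif \<Otimes>\<^sub>M unif)
      (\<lambda>i x. (\<lambda>y. (y (i, False), y (i, True))) (restrict x ({i} \<times> UNIV))) (UNIV :: nat set)"
    by (rule coords.indep_vars_compose2[OF 1]) (auto intro!: measurable_Pair measurable_component_singleton)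
  then have 2: "coords.indep_vars (\<lambda>_. unif \<Otimes>\<^sub>M unif) (\<lambda>i x. points x i) UNIV"
    by (simp add: points_def)
  have 3: "distr coords (unif \<Otimes>\<^sub>M unif) (\<lambda>x. points x i) = unif \<Otimes>\<^sub>M unif" for i
  proof -
    have "coords.indep_var unif (\<lambda>x. x (i, False)) unif (\<lambda>x. x (i, True))"
    proof -
      have "coords.indep_var
          unif ((\<lambda>y. y (i, False)) \<circ> (\<lambda>x. restrict (\<lambda>j. x j) {(i, False)}))
          unif ((\<lambda>y. y (i, True)) \<circ> (\<lambda>x. restrict (\<lambda>j. x j) {(i, True)}))"
        by (rule coords.indep_var_compose[OF coords.indep_var_restrict[OF indep_coords]]) auto
      then show ?thesis by (simp add: comp_def)
    qed
    then have "unif \<Otimes>\<^sub>M unif = distr coords (unif \<Otimes>\<^sub>M unif) (\<lambda>x. (x (i, False), x (i, True)))"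
      by (subst (asm) coords.indep_var_distribution_eq) (simp add: distr_coord)
    then show ?thesis by (simp add: points_def)
  qed
  show ?thesis
    using 2 by (subst (asm) coords.indep_vars_iff_distr_eq_PiM') (simp_all add: 3 restrict_def)
qed

text \<open>Resampling the coordinate \<open>a\<close> alone turns \<open>x a = x b\<close> into the
  event that a uniform variable hits a given value, which is null; there are only countably many
  pairs.\<close>

lemma AE_coords_distinct: "AE x in coords. inj x"
proof -
  have "AE x in coords. x a \<noteq> x b" if "a \<noteq> b" for a b :: "nat \<times> bool"
  proof -
    let ?f = "\<lambda>x. indicator {x. x a = x b} x :: real"
    have [measurable]: "{x. x a = x b} \<in> sets coords"
      using borel_measurable_eq[OF coord_borel[of a] coord_borel[of b]] by (simp add: space_PiM)
    have "(\<integral>x. ?f x \<partial>coords) =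
        (\<integral>x. (\<integral>y. ?f (\<lambda>i. if i \<in> {a} then y i else x i) \<partial>coords) \<partial>coords)"
    proof (rule integral_PiM_mix[OF unif.prob_space_axioms, where B=1])
      show "?f \<in> borel_measurable coords" by measurable
    qed (simp add: indicator_def)
    also have "\<dots> = (\<integral>x. 0 \<partial>coords)"
    proof (rule Bochner_Integration.integral_cong[OF refl])
      fix x :: "nat \<times> bool \<Rightarrow> real"
      have "(\<integral>y. ?f (\<lambda>i. if i \<in> {a} then y i else x i) \<partial>coords) = (\<integral>y. indicator {x b} (y a) \<partial>coords)"
        using that by (intro Bochner_Integration.integral_cong) (auto simp: indicator_def)
      also have "\<dots> = (\<integral>y. indicator {x b} y \<partial>unif)"
        by (subst (2) distr_coord[of a, symmetric], subst integral_distr) simp_all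
      also have "\<dots> = 0" by (simp add: measure_unif) (simp add: measure_def Int_insert_right)
      finally show "(\<integral>y. ?f (\<lambda>i. if i \<in> {a} then y i else x i) \<partial>coords) = 0" .
    qed
    finally have "coords.prob {x. x a = x b} = 0" by simp
    then have "{x. x a = x b} \<in> null_sets coords"
      by (auto simp: null_sets_def coords.emeasure_eq_measure)
    then show ?thesis by (intro AE_I'[where N="{x. x a = x b}"]) auto
  qed
  then have "AE x in coords. \<forall>a b. a \<noteq> b \<longrightarrow> x a \<noteq> x b"
    by (simp add: AE_all_countable)
  then show ?thesis by eventually_elim (metis injI)
qed

text \<open>Only the ordinates are shuffled. Averaging over all shuffles makes the permutation of the points
  uniform for every fixed choice of distinct coordinates.\<close>

lemma integral_coords_shuffle:
  fixes f :: "(nat \<Rightarrow> real \<times> real) \<Rightarrow> real"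
  assumes [measurable]: "f \<in> borel_measurable (PiM UNIV (\<lambda>_. unif \<Otimes>\<^sub>M unif))" and "inj \<sigma>"
  shows "(\<integral>\<omega>. f \<omega> \<partial>PiM UNIV (\<lambda>_. unif \<Otimes>\<^sub>M unif)) = (\<integral>x. f (\<lambda>i. (x (i, False), x (\<sigma> i, True))) \<partial>coords)"
proof -
  \<comment> \<open>The shuffle is an injective relabelling of the real coordinates:
    \<open>\<tau>\<close> moves the ordinates and fixes the abscissas.\<close>
  define \<tau> where "\<tau> = (\<lambda>(i, b). (if b then \<sigma> i else i, b))"
  have "inj \<tau>"
  proof (rule injI)
    fix p p' assume "\<tau> p = \<tau> p'"
    then show "p = p'"
      by (cases p; cases p') (auto simp: \<tau>_def split: if_splits dest: injD[OF assms(2)])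
  qed
  have \<tau>: "points (x \<circ> \<tau>) = (\<lambda>i. (x (i, False), x (\<sigma> i, True)))" for x
    by (simp add: points_def \<tau>_def fun_eq_iff)
  have "(\<integral>\<omega>. f \<omega> \<partial>PiM UNIV (\<lambda>_. unif \<Otimes>\<^sub>M unif)) = (\<integral>x. f (points x) \<partial>coords)"
    by (subst distr_points[symmetric], rule integral_distr) measurable
  also have "\<dots> = (\<integral>x. f (points (x \<circ> \<tau>)) \<partial>coords)"
    by (rule integral_PiM_comp_inj[symmetric, OF unif.prob_space_axioms \<open>inj \<tau>\<close>]) measurable
  finally show ?thesis unfolding \<tau> .
qed

text \<open>The U-statistic \<open>U n\<close> of the kernel in
  \<open>symmetric_kernel_forms_pattern\<close>, in a form available outside the locale.\<close>

definition count_pattern :: "nat \<Rightarrow> (nat \<Rightarrow> nat) \<Rightarrow> nat \<Rightarrow> (nat \<Rightarrow> real \<times> real) \<Rightarrow> real" where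
  "count_pattern k q n \<omega> = (\<Sum>S | S \<subseteq> {1..n} \<and> card S = k. of_bool (forms_pattern k q S \<omega>))"

lemma count_pattern_measurable [measurable]:
  "count_pattern k q n \<in> borel_measurable (PiM UNIV (\<lambda>_. unif \<Otimes>\<^sub>M unif))"
  unfolding count_pattern_def
proof (intro borel_measurable_sum)
  fix S assume "S \<in> {S. S \<subseteq> {1..n} \<and> card S = k}"
  then have "finite S" using finite_subset by auto
  from measurable_forms_pattern[OF this]
  show "(\<lambda>\<omega>. of_bool (forms_pattern k q S \<omega>) :: real) \<in> borel_measurable (PiM UNIV (\<lambda>_. unif \<Otimes>\<^sub>M unif))"
    by measurable
qed

text \<open>The fixed coordinates determine the rank permutations \<open>a\<close> and
  \<open>b\<close>; as \<open>\<sigma>\<close> runs through all permutations, so does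
  \<open>b \<circ> \<sigma> \<circ> inv a\<close>.\<close>

lemma sum_permutations_count_pattern:
  fixes F :: "real \<Rightarrow> real"
  assumes "inj x"
  shows "(\<Sum>\<sigma> | \<sigma> permutes {1..n}. F (count_pattern k q n (\<lambda>i. (x (i, False), x (\<sigma> i, True))))) =
    (\<Sum>p | p permutes {1..n}. F (num_occurrences k q n p))"
proof -
  have "inj_on (\<lambda>i. x (i, c)) {1..n}" for c :: bool using assms by (auto simp: inj_def inj_on_def)
  from rank_permutation[OF this] obtain r where r: "\<And>c. r c permutes {1..n}"
    "\<And>c. \<forall>i\<in>{1..n}. \<forall>j\<in>{1..n}. r c i < r c j \<longleftrightarrow> x (i, c) < x (j, c)"
    by metis
  let ?a = "r False" and ?b = "r True"
  have "(\<Sum>\<sigma> | \<sigma> permutes {1..n}. F (count_pattern k q n (\<lambda>i. (x (i, False), x (\<sigma> i, True))))) =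
      (\<Sum>\<sigma> | \<sigma> permutes {1..n}. F (num_occurrences k q n (?b \<circ> \<sigma> \<circ> inv ?a)))"
  proof (intro sum.cong refl arg_cong[where f=F])
    fix \<sigma> assume "\<sigma> \<in> {\<sigma>. \<sigma> permutes {1..n}}"
    then show "count_pattern k q n (\<lambda>i. (x (i, False), x (\<sigma> i, True))) = num_occurrences k q n (?b \<circ> \<sigma> \<circ> inv ?a)"
      unfolding count_pattern_def
      by (intro num_occurrences_rank[symmetric, where v="\<lambda>i. x (i, True)"] r) simp
  qed
  also have "\<dots> = (\<Sum>p | p permutes {1..n}. F (num_occurrences k q n p))"
  proof (rule sum.reindex_bij_witness[where i="\<lambda>p. inv ?b \<circ> p \<circ> ?a" and j="\<lambda>\<sigma>. ?b \<circ> \<sigma> \<circ> inv ?a"])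
    fix p assume p: "p \<in> {p. p permutes {1..n}}"
    show "inv ?b \<circ> (?b \<circ> p \<circ> inv ?a) \<circ> ?a = p" "?b \<circ> (inv ?b \<circ> p \<circ> ?a) \<circ> inv ?a = p"
      using permutes_inverses[OF r(1)] by (simp_all add: fun_eq_iff)
    show "?b \<circ> p \<circ> inv ?a \<in> {p. p permutes {1..n}}" "inv ?b \<circ> p \<circ> ?a \<in> {p. p permutes {1..n}}"
      using p r(1) by (simp_all add: permutes_compose permutes_inv)
  qed simp
  finally show ?thesis .
qed

text \<open>Each shuffle leaves the mean of the indicator of \<open>A\<close> unchanged. Summed over
  all shuffles, the integrand is almost surely a constant: the number of permutations whose count
  lies in \<open>A\<close>.\<close>

lemma distr_count_pattern:
  "distr (PiM UNIV (\<lambda>_. unif \<Otimes>\<^sub>M unif)) borel (count_pattern k q n) =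
    distr (measure_pmf (random_permutation n)) borel (\<lambda>p. real (num_occurrences k q n p))"
  (is "?L = ?R")
proof (rule measure_eqI)
  interpret P: prob_space "PiM UNIV (\<lambda>_::nat. unif \<Otimes>\<^sub>M unif)"
    by (rule prob_space_PiM) (rule unif2.prob_space_axioms)
  fix A assume "A \<in> sets ?L"
  then have A[measurable]: "A \<in> sets borel" by simp
  let ?\<Pi> = "{p. p permutes {1..n}}"
  have fin: "finite ?\<Pi>" "?\<Pi> \<noteq> {}" by (auto simp: finite_permutations intro: permutes_id)
  let ?F = "indicator A :: real \<Rightarrow> real"
  define I where "I = (\<integral>\<omega>. ?F (count_pattern k q n \<omega>) \<partial>PiM UNIV (\<lambda>_. unif \<Otimes>\<^sub>M unif))"
  let ?G = "\<lambda>\<sigma> x. ?F (count_pattern k q n (\<lambda>i. (x (i, False), x (\<sigma> i, True))))"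
  have G: "(\<lambda>x. ?G \<sigma> x) \<in> borel_measurable coords" for \<sigma>
    by measurable
  have "card ?\<Pi> * I = (\<Sum>\<sigma>\<in>?\<Pi>. I)" by simp
  also have "\<dots> = (\<Sum>\<sigma>\<in>?\<Pi>. \<integral>x. ?G \<sigma> x \<partial>coords)"
    unfolding I_def by (intro sum.cong refl integral_coords_shuffle) (auto intro: permutes_inj)
  also have "\<dots> = (\<integral>x. (\<Sum>\<sigma>\<in>?\<Pi>. ?G \<sigma> x) \<partial>coords)"
    using G by (intro Bochner_Integration.integral_sum[symmetric] coords.integrable_const_bound[where B=1])
      (auto simp: indicator_def)
  also have "\<dots> = (\<integral>x. (\<Sum>p\<in>?\<Pi>. ?F (num_occurrences k q n p)) \<partial>coords)"
    by (intro integral_cong_AE borel_measurable_sum borel_measurable_const G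
      eventually_mono[OF AE_coords_distinct] sum_permutations_count_pattern)
  also have "\<dots> = (\<Sum>p\<in>?\<Pi>. ?F (num_occurrences k q n p))" by (simp add: coords.P.prob_space)
  also have "\<dots> = card ?\<Pi> * measure_pmf.expectation (random_permutation n) (\<lambda>p. ?F (num_occurrences k q n p))"
    unfolding random_permutation_def using fin by (subst integral_pmf_of_set) auto
  finally have "card ?\<Pi> * I =
      card ?\<Pi> * measure_pmf.expectation (random_permutation n) (\<lambda>p. ?F (num_occurrences k q n p))" .
  moreover have "real (card ?\<Pi>) \<noteq> 0" using fin by (metis card_0_eq of_nat_eq_0_iff)
  ultimately have "I = measure_pmf.expectation (random_permutation n) (\<lambda>p. ?F (num_occurrences k q n p))"
    by (metis mult_left_cancel)
  moreover have "I = measure ?L A"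
  proof -
    have "I = (\<integral>y. ?F y \<partial>?L)" unfolding I_def by (subst integral_distr) auto
    then show ?thesis by simp
  qed
  moreover have "measure_pmf.expectation (random_permutation n) (\<lambda>p. ?F (num_occurrences k q n p)) = measure ?R A"
  proof -
    have "measure_pmf.expectation (random_permutation n) (\<lambda>p. ?F (num_occurrences k q n p)) = (\<integral>y. ?F y \<partial>?R)"
      by (subst integral_distr) auto
    then show ?thesis by simp
  qed
  ultimately have "measure ?L A = measure ?R A" by simp
  moreover have "prob_space ?L" "prob_space ?R"
    by (auto intro!: P.prob_space_distr measure_pmf.prob_space_distr)
  ultimately show "emeasure ?L A = emeasure ?R A"
    by (simp add: finite_measure.emeasure_eq_measure prob_space.finite_measure)
qed simp

section \<open>Non-degeneracy of pattern counts\<close>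

lemma measure_unif_times:
  assumes "A \<in> sets borel" "B \<in> sets borel"
  shows "measure (unif \<Otimes>\<^sub>M unif) (A \<times> B) = measure unif A * measure unif B"
  using unif.emeasure_pair_measure_Times[of A unif B] assms by (simp add: measure_def enn2real_mult)

lemma num_occurrences_self:
  assumes "q permutes {1..k}"
  shows "num_occurrences k q k q \<ge> 1"
proof -
  have "pattern_occurrence k q k q {1..k}"
    unfolding pattern_occurrence_def by (auto intro!: exI[of _ "\<lambda>i. i"] strict_mono_onI)
  moreover have "finite {S. pattern_occurrence k q k q S}"
    by (rule finite_subset[of _ "Pow {1..k}"]) (auto simp: pattern_occurrence_def)
  ultimately show ?thesis
    unfolding num_occurrences_def by (simp add: Suc_le_eq card_gt_0_iff) blast
qed

text \<open>\<open>rest\<close> keeps the other points out of the left strip and out of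
  \<open>Y\<close>, so \<open>z\<close> is leftmost and also lowest or highest. As leftmost point it
  must come first in the enumeration, and comparing it with the second point contradicts the choice
  of \<open>Y\<close>.\<close>

lemma not_forms_pattern_corner:
  fixes q :: "nat \<Rightarrow> nat"
  assumes k: "k \<ge> 2" and q: "inj_on q {1..k}" 
    and Y: "Y = (if q 2 < q 1 then {..<\<delta>} else {1 - \<delta><..})"
    and z: "fst z < \<delta>" "snd z \<in> Y"
    and rest: "\<And>i. i \<in> {2..k} \<Longrightarrow> fst (\<omega> i) \<ge> \<delta> \<and> snd (\<omega> i) \<notin> Y"
  shows "\<not> forms_pattern k q {1..k} (fun_upd \<omega> 1 z)"
proof
  let ?\<omega> = "fun_upd \<omega> 1 z"
  assume "forms_pattern k q {1..k} ?\<omega>"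
  then obtain e where e: "bij_betw e {1..k} {1..k}"
    and P: "\<And>j r. j \<in> {1..k} \<Longrightarrow> r \<in> {1..k} \<Longrightarrow> (j < r \<longleftrightarrow> fst (?\<omega> (e j)) < fst (?\<omega> (e r))) \<and>
        (q j < q r \<longleftrightarrow> snd (?\<omega> (e j)) < snd (?\<omega> (e r)))"
    unfolding forms_pattern_def by blast
  have 12: "1 \<in> {1..k}" "2 \<in> {1..k}" using k by auto
  have rest': "fst (?\<omega> (e j)) \<ge> \<delta> \<and> snd (?\<omega> (e j)) \<notin> Y" if "j \<in> {1..k}" "e j \<noteq> 1" for j
    using rest[of "e j"] bij_betwE[OF e] that by fastforce
  obtain j0 where j0: "j0 \<in> {1..k}" "e j0 = 1"
    using bij_betw_imp_surj_on[OF e] 12(1) by (metis imageE)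
  have "j0 = 1"
  proof (rule ccontr)
    assume "j0 \<noteq> 1"
    then have "1 < j0" "e 1 \<noteq> 1"
      using j0 12 inj_onD[OF bij_betw_imp_inj_on[OF e], of 1 j0] by auto
    then show False using P[OF 12(1) j0(1)] rest'[OF 12(1)] j0(2) z(1) by simp
  qed
  then have e1: "e 1 = 1" using j0 by simp
  have "e 2 \<noteq> 1" using inj_onD[OF bij_betw_imp_inj_on[OF e], of 1 2] 12 e1 by auto
  note 2 = rest'[OF 12(2) this]
  show False
  proof (cases "q 2 < q 1")
    case True
    then show False using P[OF 12(2) 12(1)] 2 z(2) e1 unfolding Y by simp
  next
    case False
    moreover have "q 1 \<noteq> q 2" using inj_onD[OF q, of 1 2] 12 by auto
    ultimately show False using P[OF 12] 2 z(2) e1 unfolding Y by simp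
  qed
qed

lemma projection_nondegenerate:
  fixes k :: nat and q :: "nat \<Rightarrow> nat"
  assumes k: "k \<ge> 2" and q: "q permutes {1..k}"
  shows "symmetric_kernel.\<sigma>2 (unif \<Otimes>\<^sub>M unif) k (\<lambda>S \<omega>. of_bool (forms_pattern k q S \<omega>)) > 0"
proof -
  let ?\<phi> = "\<lambda>S \<omega>. of_bool (forms_pattern k q S \<omega>) :: real" and ?N = "unif \<Otimes>\<^sub>M unif"
  interpret K: symmetric_kernel ?N k ?\<phi> 1
    by (rule symmetric_kernel_forms_pattern[OF k])
  have U: "K.U n = count_pattern k q n" for n
    unfolding K.U_def count_pattern_def by auto
  \<comment> \<open>For \<open>n = k\<close> the U-statistic is the kernel itself. The equality in
    law makes \<open>\<theta>\<close> the mean number of copies of \<open>q\<close> in a random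
    permutation of length \<open>k\<close>, and \<open>q\<close> contains itself.\<close>
  have "K.\<theta> > 0"
  proof -
    have "{S. S \<subseteq> {1..k} \<and> card S = k} = {{1..k}}"
      using card_subset_eq[of "{1..k}"] by auto
    then have "count_pattern k q k \<omega> = ?\<phi> {1..k} \<omega>" for \<omega>
      unfolding count_pattern_def by simp
    then have "K.\<theta> = (\<integral>\<omega>. count_pattern k q k \<omega> \<partial>PiM UNIV (\<lambda>_. ?N))"
      unfolding K.\<theta>_def K.\<Omega>_def by simp
    also have "\<dots> = (\<integral>y. y \<partial>distr (PiM UNIV (\<lambda>_. ?N)) borel (count_pattern k q k))"
      by (subst integral_distr) simp_all
    also have "\<dots> = measure_pmf.expectation (random_permutation k) (\<lambda>p. real (num_occurrences k q k p))"
      unfolding distr_count_pattern by (subst integral_distr) simp_all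
    also have "\<dots> = (\<Sum>p | p permutes {1..k}. real (num_occurrences k q k p)) / card {p. p permutes {1..k}}"
      unfolding random_permutation_def
      by (intro integral_pmf_of_set) (auto simp: finite_permutations intro: permutes_id)
    also have "\<dots> > 0"
    proof (intro divide_pos_pos)
      have "0 < real (num_occurrences k q k q)" using num_occurrences_self[OF q] by simp
      also have "\<dots> \<le> (\<Sum>p | p permutes {1..k}. real (num_occurrences k q k p))"
        using q by (intro member_le_sum) (auto simp: finite_permutations)
      finally show "0 < (\<Sum>p | p permutes {1..k}. real (num_occurrences k q k p))" .
      show "0 < real (card {p. p permutes {1..k}})"
        using q by (auto simp: card_gt_0_iff finite_permutations)
    qed
    finally show ?thesis .
  qed
  \<comment> \<open>The visits of the other \<open>k - 1\<close> points to the two strips have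
    expected number \<open>2 * (k - 1) * \<delta>\<close>, which \<open>\<theta> / (4 * k)\<close>
    keeps at most \<open>\<theta> / 2\<close>; the cap 1/2 keeps the strips inside the unit
    interval.\<close>
  define \<delta> where "\<delta> = min (1 / 2) (K.\<theta> / (4 * k))"
  have \<delta>: "\<delta> > 0" "\<delta> \<le> 1 / 2" "\<delta> \<le> K.\<theta> / (4 * k)"
    using \<open>K.\<theta> > 0\<close> k by (simp_all add: \<delta>_def)
  define Y :: "real set" where "Y = (if q 2 < q 1 then {..<\<delta>} else {1 - \<delta><..})"
  let ?X = "{..<\<delta>}"
  have [measurable]: "Y \<in> sets borel" unfolding Y_def by simp
  have "{0..1} \<inter> ?X = {0..<\<delta>}" "{0..1} \<inter> {1 - \<delta><..} = {1 - \<delta><..1}" using \<delta> by auto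
  then have m: "measure unif ?X = \<delta>" "measure unif Y = \<delta>"
    using \<delta>(1) by (simp_all add: measure_unif Y_def)
  have h: "K.h z \<le> K.\<theta> / 2" if z: "fst z < \<delta>" "snd z \<in> Y" for z
  proof -
    \<comment> \<open>Counts the strips that contain a point. An occurrence that uses the corner
      point forces some other point into a strip, so the sum over these points dominates the
      kernel.\<close>
    let ?g = "\<lambda>z. indicator (?X \<times> UNIV) z + indicator (UNIV \<times> Y) z :: real"
    have sets: "?X \<times> UNIV \<in> sets ?N" "UNIV \<times> Y \<in> sets ?N" by (auto intro!: pair_measureI)
    have g: "bounded_measurable ?N ?g"
      by (rule bounded_measurableI[where B=2]) (use sets in \<open>measurable, auto simp: indicator_def\<close>)
    have gi: "bounded_measurable K.\<Omega> (\<lambda>\<omega>. ?g (\<omega> i))" for i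
      by (rule bounded_measurable_compose[OF g K.component_measurable])
    have "(\<integral>z. ?g z \<partial>?N) = measure ?N (?X \<times> UNIV) + measure ?N (UNIV \<times> Y)"
      using sets by (subst Bochner_Integration.integral_add) (auto simp: unif2.emeasure_eq_measure less_top)
    also have "\<dots> = 2 * \<delta>"
      using unif.prob_space by (subst (1 2) measure_unif_times) (auto simp: m)
    finally have int_g: "(\<integral>z. ?g z \<partial>?N) = 2 * \<delta>" .
    have "K.h z = (\<integral>\<omega>. ?\<phi> {1..k} (fun_upd \<omega> 1 z) \<partial>K.\<Omega>)" unfolding K.h_def ..
    also have "\<dots> \<le> (\<integral>\<omega>. (\<Sum>i=2..k. ?g (\<omega> i)) \<partial>K.\<Omega>)"
    proof (rule integral_mono)
      show "integrable K.\<Omega> (\<lambda>\<omega>. ?\<phi> {1..k} (fun_upd \<omega> 1 z))"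
        by (intro K.O.integrable_bounded_measurable K.bm_\<phi>_upd) (simp_all add: space_pair_measure)
      show "integrable K.\<Omega> (\<lambda>\<omega>. \<Sum>i=2..k. ?g (\<omega> i))"
        by (intro K.O.integrable_bounded_measurable bounded_measurable_sum gi)
      fix \<omega> :: "nat \<Rightarrow> real \<times> real"
      show "?\<phi> {1..k} (fun_upd \<omega> 1 z) \<le> (\<Sum>i=2..k. ?g (\<omega> i))"
      proof (cases "\<forall>i\<in>{2..k}. fst (\<omega> i) \<ge> \<delta> \<and> snd (\<omega> i) \<notin> Y")
        case True
        then have "\<not> forms_pattern k q {1..k} (fun_upd \<omega> 1 z)"
          using permutes_inj_on[OF q] by (intro not_forms_pattern_corner[OF k _ Y_def z]) auto
        then show ?thesis by (simp add: sum_nonneg)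
      next
        case False
        then obtain i where i: "i \<in> {2..k}" "fst (\<omega> i) < \<delta> \<or> snd (\<omega> i) \<in> Y" by force
        then have "1 \<le> ?g (\<omega> i)" by (cases "\<omega> i") (auto simp: indicator_def)
        also have "\<dots> \<le> (\<Sum>i=2..k. ?g (\<omega> i))" using i by (intro member_le_sum) auto
        finally show ?thesis by (rule order_trans[rotated]) simp
      qed
    qed
    also have "\<dots> = (\<Sum>i=2..k. \<integral>\<omega>. ?g (\<omega> i) \<partial>K.\<Omega>)"
      by (intro Bochner_Integration.integral_sum K.O.integrable_bounded_measurable gi)
    also have "\<dots> = (\<Sum>i=2..k. 2 * \<delta>)"
      by (simp only: K.integral_component[OF bounded_measurableD[OF g]] int_g)
    also have "\<dots> = (real k - 1) * (2 * \<delta>)" using k by (simp add: of_nat_diff)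
    also have "\<dots> \<le> k * (2 * (K.\<theta> / (4 * k)))"
      using \<delta> k by (intro mult_mono) simp_all
    also have "\<dots> = K.\<theta> / 2" using k by simp
    finally show ?thesis .
  qed
  show ?thesis
  proof (rule ccontr)
    \<comment> \<open>Zero variance would force \<open>h = \<theta>\<close> almost everywhere,
      against \<open>h \<le> \<theta> / 2\<close> on a corner square of measure
      \<open>\<delta> * \<delta>\<close>.\<close>
    assume "\<not> ?thesis"
    moreover have "K.\<sigma>2 \<ge> 0" unfolding K.\<sigma>2_def by simp
    ultimately have "(\<integral>z. (K.h z - K.\<theta>)\<^sup>2 \<partial>?N) = 0" unfolding K.\<sigma>2_def by simp
    moreover have "integrable ?N (\<lambda>z. (K.h z - K.\<theta>)\<^sup>2)"
      by (intro prob_space.integrable_bounded_measurable[OF unif2.prob_space_axioms] bounded_measurable_intros K.bm_h)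
    ultimately have "AE z in ?N. (K.h z - K.\<theta>)\<^sup>2 = 0"
      by (subst (asm) integral_nonneg_eq_0_iff_AE) simp_all
    then have "AE z in ?N. z \<notin> ?X \<times> Y"
    proof eventually_elim
      case (elim z)
      then have "K.h z = K.\<theta>" by simp
      then show ?case using h[of z] \<open>K.\<theta> > 0\<close> by (cases z) auto
    qed
    moreover have XY: "?X \<times> Y \<in> sets ?N" by (auto intro!: pair_measureI)
    ultimately have "?X \<times> Y \<in> null_sets ?N" using AE_iff_null_sets[OF XY] by blast
    then have "measure ?N (?X \<times> Y) = 0" by (rule measure_eq_0_null_sets)
    moreover have "measure ?N (?X \<times> Y) = \<delta> * \<delta>"
      by (subst measure_unif_times) (simp_all add: m)
    ultimately show False using \<delta> by simp
  qed
qed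

theorem theorem2:
  fixes k :: nat and q :: "nat \<Rightarrow> nat"
  assumes "k \<ge> 2" and "q permutes {1..k}"
  shows "weak_conv_m
    (\<lambda>n. distr (measure_pmf (random_permutation n)) borel
       (standardized (random_permutation n) (\<lambda>p. real (num_occurrences k q n p))))
    std_normal_distribution"
proof -
  let ?N = "unif \<Otimes>\<^sub>M unif"
  interpret K: symmetric_kernel ?N k "\<lambda>S \<omega>. of_bool (forms_pattern k q S \<omega>) :: real" 1
    by (rule symmetric_kernel_forms_pattern[OF assms(1)])
  have U: "K.U n = count_pattern k q n" for n
    unfolding K.U_def count_pattern_def by auto
  have "distr K.\<Omega> borel (\<lambda>\<omega>. (K.U n \<omega> - K.O.expectation (K.U n)) / sqrt (K.O.variance (K.U n))) =
      distr (measure_pmf (random_permutation n)) borel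
       (standardized (random_permutation n) (\<lambda>p. real (num_occurrences k q n p)))" for n
  proof -
    \<comment> \<open>Mean and variance, hence the standardizing map, are read off the common law
      \<open>D\<close>, so they agree on both probability spaces.\<close>
    define D where "D = distr (measure_pmf (random_permutation n)) borel (\<lambda>p. real (num_occurrences k q n p))"
    have D: "D = distr K.\<Omega> borel (K.U n)"
      unfolding D_def U K.\<Omega>_def distr_count_pattern ..
    have [measurable]: "K.U n \<in> borel_measurable K.\<Omega>" by (rule bounded_measurableD[OF K.bm_U])
    define m where "m = (\<integral>y. y \<partial>D)"
    define v where "v = (\<integral>y. (y - m)\<^sup>2 \<partial>D)"
    have mU: "K.O.expectation (K.U n) = m" "(\<integral>\<omega>. (K.U n \<omega> - m)\<^sup>2 \<partial>K.\<Omega>) = v"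
      by (simp_all add: m_def v_def D integral_distr)
    have mN: "measure_pmf.expectation (random_permutation n) (\<lambda>p. real (num_occurrences k q n p)) = m"
      "measure_pmf.expectation (random_permutation n) (\<lambda>p. (real (num_occurrences k q n p) - m)\<^sup>2) = v"
      by (simp_all add: m_def v_def D_def integral_distr)
    have "distr K.\<Omega> borel (\<lambda>\<omega>. (K.U n \<omega> - m) / sqrt v) = distr D borel (\<lambda>y. (y - m) / sqrt v)"
      unfolding D by (subst distr_distr) (simp_all add: comp_def)
    also have "\<dots> = distr (measure_pmf (random_permutation n)) borel
        (\<lambda>p. (real (num_occurrences k q n p) - m) / sqrt v)"
      unfolding D_def by (subst distr_distr) (simp_all add: comp_def)
    finally show ?thesis unfolding standardized_def mU mN .
  qed
  with K.weak_conv_U[OF projection_nondegenerate[OF assms]] show ?thesis by simp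
qed

end
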